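(* Let $\mathbf{A}=(A_s)_{s\in T}$ and $\mathbf{B}=(B_s)_{s\in T}$ be continuous fields of strictly positive operators in $\mathscr A$ such that $0<mA_s\le B_s\le MA_s$ for all $s\in T$, for some positive real numbers $m,M$ with $m<1<M$, and such that $\int_T A_s\,d\mu(s)=\int_T B_s\,d\mu(s)=I_{\mathscr H}$. Let $f:(0,\infty)\to[0,\infty)$ be operator concave, $t_0\in[m,M]$ and $p\in[0,1]$. Put $$\mu_f=\frac{f(M)-f(m)}{M-m},\qquad \nu_f=\frac{Mf(m)-mf(M)}{M-m},\qquad \zeta_f=\max_{m\le t\le M}\{f(t)-\mu_f t-\nu_f\}.$$ Then $$f\left[\int_T (A_s\natural_{p+1}B_s)\,d\mu(s)+t_0\left(I_{\mathscr H}-\int_T A_s\natural_p B_s\,d\mu(s)\right)\right]-f(t_0)\left(I_{\mathscr H}-\int_T A_s\natural_p B_s\,d\mu(s)\right)\ \le\ \widetilde S_p^f(\mathbf A|\mathbf B)+\zeta_f I_{\mathscr H}.$$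
   Context: $\mathscr H$ is a complex Hilbert space with identity operator $I_{\mathscr H}$, and $\le$ is the usual (Loewner) order on self-adjoint operators in $\mathbb B(\mathscr H)$. An operator is strictly positive if it is positive and invertible. $\mathscr A$ is a $C^*$-algebra of operators acting on $\mathscr H$, $T$ is a locally compact Hausdorff space and $\mu$ is a Radon measure on $T$. A family $(A_t)_{t\in T}$ in $\mathscr A$ is a continuous field of operators if $t\mapsto A_t$ is norm continuous and $t\mapsto\|A_t\|$ is $\mu$-integrable; its Bochner integral $\int_T A_t\,d\mu(t)$ is the unique element of $\mathscr A$ with $\varphi(\int_T A_t\,d\mu(t))=\int_T\varphi(A_t)\,d\mu(t)$ for all $\varphi\in\mathscr A^*$. A continuous function $f:J\to\mathbb R$ on an interval $J$ is operator concave if $\lambda f(X)+(1-\lambda)f(Y)\le f(\lambda X+(1-\lambda)Y)$ for all $\lambda\in[0,1]$ and all self-adjoint operators $X,Y$ (on any complex Hilbert space) with spectra in $J$. For strictly positive $X,Y$ and $q\in\mathbb R$: $X\natural_q Y=X^{1/2}(X^{-1/2}YX^{-1/2})^qX^{1/2}$ and $S_q^f(X|Y)=X^{1/2}(X^{-1/2}YX^{-1/2})^q f(X^{-1/2}YX^{-1/2})X^{1/2}$. The generalized relative operator entropy is $\widetilde S_q^f(\mathbf A|\mathbf B)=\int_T S_q^f(A_s|B_s)\,d\mu(s)$. (The real number $\mu_f$ is unrelated to the measure $\mu$.) *)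

theory Defs
  imports
    "HOL-Analysis.Analysis"
    "HOL-Computational_Algebra.Polynomial"
    "HOL-Library.Function_Algebras"
begin

section \<open>Complex Hilbert spaces as structures\<close>

text \<open>
  Operator concavity quantifies over all complex Hilbert spaces. HOL cannot quantify over types
  inside a formula, so Hilbert spaces are first treated as structures: the carrier is a subset of
  a fixed type, whose addition is used, and scalar multiplication and inner product are fields.
  Operators are functions on that type of which only the values on the carrier matter. Inner
  products are linear in the first argument.
\<close>

record 'v hilbert_structure =
  hs_carrier :: "'v set"
  hs_scale :: "complex \<Rightarrow> 'v \<Rightarrow> 'v"
  hs_inner :: "'v \<Rightarrow> 'v \<Rightarrow> complex"

definition hs_norm :: "'v hilbert_structure \<Rightarrow> 'v \<Rightarrow> real" where
  "hs_norm K x = sqrt (Re (hs_inner K x x))"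

definition hilbert_space :: "('v::ab_group_add) hilbert_structure \<Rightarrow> bool" where
  "hilbert_space K \<longleftrightarrow>
     vector_space (hs_scale K) \<and> module.subspace (hs_scale K) (hs_carrier K) \<and>
     (\<forall>x\<in>hs_carrier K. \<forall>y\<in>hs_carrier K. hs_inner K x y = cnj (hs_inner K y x)) \<and>
     (\<forall>x\<in>hs_carrier K. \<forall>y\<in>hs_carrier K. \<forall>z\<in>hs_carrier K.
        hs_inner K (x + y) z = hs_inner K x z + hs_inner K y z) \<and>
     (\<forall>c. \<forall>x\<in>hs_carrier K. \<forall>y\<in>hs_carrier K.
        hs_inner K (hs_scale K c x) y = c * hs_inner K x y) \<and>
     (\<forall>x\<in>hs_carrier K. x \<noteq> 0 \<longrightarrow> 0 < Re (hs_inner K x x)) \<and>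
     (\<forall>s. (\<forall>n. s n \<in> hs_carrier K) \<and>
          (\<forall>e>0. \<exists>N. \<forall>i\<ge>N. \<forall>j\<ge>N. hs_norm K (s i - s j) < e)
        \<longrightarrow> (\<exists>l\<in>hs_carrier K. (\<lambda>n::nat. hs_norm K (s n - l)) \<longlonglongrightarrow> 0))"

definition hs_operator :: "('v::ab_group_add) hilbert_structure \<Rightarrow> ('v \<Rightarrow> 'v) \<Rightarrow> bool" where
  "hs_operator K X \<longleftrightarrow>
     (\<forall>x\<in>hs_carrier K. X x \<in> hs_carrier K) \<and>
     (\<forall>x\<in>hs_carrier K. \<forall>y\<in>hs_carrier K. X (x + y) = X x + X y) \<and>
     (\<forall>c. \<forall>x\<in>hs_carrier K. X (hs_scale K c x) = hs_scale K c (X x)) \<and>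
     (\<exists>C. \<forall>x\<in>hs_carrier K. hs_norm K (X x) \<le> C * hs_norm K x)"

definition hs_onorm :: "('v::ab_group_add) hilbert_structure \<Rightarrow> ('v \<Rightarrow> 'v) \<Rightarrow> real" where
  "hs_onorm K X = (SUP x\<in>{x \<in> hs_carrier K. hs_norm K x \<le> 1}. hs_norm K (X x))"

definition hs_selfadjoint :: "('v::ab_group_add) hilbert_structure \<Rightarrow> ('v \<Rightarrow> 'v) \<Rightarrow> bool" where
  "hs_selfadjoint K X \<longleftrightarrow> hs_operator K X \<and>
     (\<forall>x\<in>hs_carrier K. \<forall>y\<in>hs_carrier K. hs_inner K (X x) y = hs_inner K x (X y))"

definition hs_le ::
  "('v::ab_group_add) hilbert_structure \<Rightarrow> ('v \<Rightarrow> 'v) \<Rightarrow> ('v \<Rightarrow> 'v) \<Rightarrow> bool" where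
  "hs_le K X Y \<longleftrightarrow> hs_selfadjoint K X \<and> hs_selfadjoint K Y \<and>
     (\<forall>x\<in>hs_carrier K. Re (hs_inner K (X x) x) \<le> Re (hs_inner K (Y x) x))"

definition hs_spectrum ::
  "('v::ab_group_add) hilbert_structure \<Rightarrow> ('v \<Rightarrow> 'v) \<Rightarrow> complex set" where
  "hs_spectrum K X = {z. \<not> (\<exists>Y. hs_operator K Y \<and>
     (\<forall>x\<in>hs_carrier K. Y (X x - hs_scale K z x) = x \<and> X (Y x) - hs_scale K z (Y x) = x))}"

definition hs_poly ::
  "('v::ab_group_add) hilbert_structure \<Rightarrow> real poly \<Rightarrow> ('v \<Rightarrow> 'v) \<Rightarrow> 'v \<Rightarrow> 'v" where
  "hs_poly K P X x = (\<Sum>i\<le>degree P. hs_scale K (complex_of_real (coeff P i)) ((X ^^ i) x))"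

text \<open>
  The continuous functional calculus: for self-adjoint \<open>X\<close> and \<open>f\<close> continuous on the spectrum,
  \<open>f(X)\<close> is the norm limit of \<open>P n (X)\<close> for polynomials \<open>P n\<close> converging to \<open>f\<close> uniformly on the
  spectrum. Stated as a relation because \<open>f(X)\<close> is determined on the carrier only.
\<close>

definition hs_has_cfc :: "('v::ab_group_add) hilbert_structure \<Rightarrow> (real \<Rightarrow> real) \<Rightarrow>
    ('v \<Rightarrow> 'v) \<Rightarrow> ('v \<Rightarrow> 'v) \<Rightarrow> bool" where
  "hs_has_cfc K f X Y \<longleftrightarrow> hs_operator K Y \<and>
     (\<exists>P :: nat \<Rightarrow> real poly.
        uniform_limit {t. complex_of_real t \<in> hs_spectrum K X} (\<lambda>n t. poly (P n) t) f sequentially \<and>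
        (\<lambda>n. hs_onorm K (\<lambda>x. hs_poly K (P n) X x - Y x)) \<longlonglongrightarrow> 0)"

text \<open>
  The type argument bounds the universe of Hilbert spaces. For an infinite type \<open>'u\<close>, every complex
  Hilbert space having an orthonormal basis of cardinality at most that of \<open>'u\<close> is isomorphic to
  one with carrier inside \<open>'u \<Rightarrow> complex\<close>, namely the square-summable families supported on a
  subset of \<open>'u\<close>.
\<close>

definition operator_concave ::
  "('v::ab_group_add) itself \<Rightarrow> real set \<Rightarrow> (real \<Rightarrow> real) \<Rightarrow> bool" where
  "operator_concave U J f \<longleftrightarrow> is_interval J \<and> continuous_on J f \<and>
     (\<forall>K :: 'v hilbert_structure. hilbert_space K \<longrightarrow>
       (\<forall>X Y FX FY FZ. \<forall>l\<in>{0..1}.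
          hs_selfadjoint K X \<and> hs_selfadjoint K Y \<and>
          hs_spectrum K X \<subseteq> complex_of_real ` J \<and> hs_spectrum K Y \<subseteq> complex_of_real ` J \<and>
          hs_has_cfc K f X FX \<and> hs_has_cfc K f Y FY \<and>
          hs_has_cfc K f
            (\<lambda>x. hs_scale K (complex_of_real l) (X x) + hs_scale K (complex_of_real (1 - l)) (Y x)) FZ
          \<longrightarrow> hs_le K
            (\<lambda>x. hs_scale K (complex_of_real l) (FX x) + hs_scale K (complex_of_real (1 - l)) (FY x)) FZ))"


section \<open>Complex Hilbert spaces as types\<close>

class complex_hilbert = banach +
  fixes scaleC :: "complex \<Rightarrow> 'a \<Rightarrow> 'a"
    and cinner :: "'a \<Rightarrow> 'a \<Rightarrow> complex"
  assumes scaleC_add_right: "scaleC c (x + y) = scaleC c x + scaleC c y"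
    and scaleC_add_left: "scaleC (c + d) x = scaleC c x + scaleC d x"
    and scaleC_scaleC: "scaleC c (scaleC d x) = scaleC (c * d) x"
    and scaleC_of_real: "scaleC (complex_of_real r) x = r *\<^sub>R x"
    and cinner_commute: "cinner x y = cnj (cinner y x)"
    and cinner_add_left: "cinner (x + y) z = cinner x z + cinner y z"
    and cinner_scaleC_left: "cinner (scaleC c x) y = c * cinner x y"
    and norm_eq_sqrt_cinner: "norm x = sqrt (Re (cinner x x))"

instantiation complex :: complex_hilbert
begin

definition "scaleC c (x::complex) = c * x"
definition "cinner (x::complex) y = x * cnj y"

instance
  by standard
    (auto simp: scaleC_complex_def cinner_complex_def algebra_simps scaleR_conv_of_real
      cmod_def power2_eq_square)

end

definition hs_UNIV :: "('h::complex_hilbert) hilbert_structure" where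
  "hs_UNIV = \<lparr>hs_carrier = UNIV, hs_scale = scaleC, hs_inner = cinner\<rparr>"

lemma hs_norm_UNIV: "hs_norm hs_UNIV = (norm :: 'h::complex_hilbert \<Rightarrow> real)"
  by (auto simp: hs_norm_def hs_UNIV_def norm_eq_sqrt_cinner)

lemma hilbert_space_UNIV: "hilbert_space (hs_UNIV :: ('h::complex_hilbert) hilbert_structure)"
proof -
  have vs: "vector_space (scaleC :: complex \<Rightarrow> 'h \<Rightarrow> 'h)"
  proof
    show "scaleC 1 x = x" for x :: 'h
      using scaleC_of_real[of 1 x] by simp
  qed (simp_all add: scaleC_add_right scaleC_add_left scaleC_scaleC)
  have sub: "module.subspace (scaleC :: complex \<Rightarrow> 'h \<Rightarrow> 'h) UNIV"
    using vs by (simp add: module.subspace_def vector_space_def module_def)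
  have pos: "0 < Re (cinner x x)" if "x \<noteq> 0" for x :: 'h
    using that norm_eq_sqrt_cinner[of x] by (metis real_sqrt_gt_0_iff zero_less_norm_iff)
  have compl: "\<exists>l. (\<lambda>n. norm (s n - l)) \<longlonglongrightarrow> 0"
    if "\<forall>e>0. \<exists>N. \<forall>i\<ge>N. \<forall>j\<ge>N. norm (s i - s j) < e" for s :: "nat \<Rightarrow> 'h"
  proof -
    have "Cauchy s"
      using that by (auto simp: Cauchy_iff)
    then obtain l where "s \<longlonglongrightarrow> l"
      using Cauchy_convergent_iff convergent_def by blast
    then show ?thesis
      using LIM_zero_iff tendsto_norm_zero by blast
  qed
  show ?thesis
    unfolding hilbert_space_def hs_norm_UNIV
    using vs sub pos compl
    by (auto simp: hs_UNIV_def cinner_add_left cinner_scaleC_left intro: cinner_commute)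
qed

lemma norm_scaleC: "norm (scaleC c x) = cmod c * norm (x::'h::complex_hilbert)"
proof -
  have r: "cinner y (scaleC c z) = cnj c * cinner y z" for y z :: 'h
    by (metis cinner_commute cinner_scaleC_left complex_cnj_mult)
  have "cinner (scaleC c x) (scaleC c x) = complex_of_real ((cmod c)\<^sup>2) * cinner x x"
    by (simp add: cinner_scaleC_left r complex_norm_square mult.assoc del: of_real_power)
  then show ?thesis
    by (simp add: norm_eq_sqrt_cinner[of "scaleC c x"] norm_eq_sqrt_cinner[of x] real_sqrt_mult
        del: of_real_power)
qed

lemma bounded_linear_scaleC: "bounded_linear (scaleC c :: 'h::complex_hilbert \<Rightarrow> 'h)"
proof (rule bounded_linear_intro[of _ "cmod c"])
  show "scaleC c (r *\<^sub>R x) = r *\<^sub>R scaleC c x" for r and x :: 'h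
    by (simp flip: scaleC_of_real add: scaleC_scaleC mult.commute)
qed (simp_all add: scaleC_add_right norm_scaleC mult.commute)


section \<open>Bounded operators\<close>

text \<open>
  Operators on a Hilbert space type are bounded real-linear functions satisfying \<open>clinear_op\<close>;
  their norm and topology are those of \<open>blinfun\<close>.
\<close>

definition clinear_op :: "('h::complex_hilbert \<Rightarrow>\<^sub>L 'h) \<Rightarrow> bool" where
  "clinear_op X \<longleftrightarrow> (\<forall>c x. X (scaleC c x) = scaleC c (X x))"

definition op_scaleC :: "complex \<Rightarrow> ('h::complex_hilbert \<Rightarrow>\<^sub>L 'h) \<Rightarrow> ('h \<Rightarrow>\<^sub>L 'h)" where
  "op_scaleC c X = Blinfun (\<lambda>x. scaleC c (X x))"

lemma op_scaleC_apply: "op_scaleC c X x = scaleC c (X x)"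
proof -
  have "bounded_linear (\<lambda>x. scaleC c (X x))"
    using bounded_linear_compose[OF bounded_linear_scaleC blinfun.bounded_linear_right] .
  then show ?thesis
    by (simp add: op_scaleC_def bounded_linear_Blinfun_apply)
qed

definition op_le :: "('h::complex_hilbert \<Rightarrow>\<^sub>L 'h) \<Rightarrow> ('h \<Rightarrow>\<^sub>L 'h) \<Rightarrow> bool"
    (infix "\<preceq>\<^sub>L" 50) where
  "X \<preceq>\<^sub>L Y \<longleftrightarrow> hs_le hs_UNIV (blinfun_apply X) (blinfun_apply Y)"

definition strictly_positive :: "('h::complex_hilbert \<Rightarrow>\<^sub>L 'h) \<Rightarrow> bool" where
  "strictly_positive X \<longleftrightarrow> 0 \<preceq>\<^sub>L X \<and>
     (\<exists>Y. clinear_op Y \<and> X o\<^sub>L Y = id_blinfun \<and> Y o\<^sub>L X = id_blinfun)"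

definition cfc :: "(real \<Rightarrow> real) \<Rightarrow> ('h::complex_hilbert \<Rightarrow>\<^sub>L 'h) \<Rightarrow> ('h \<Rightarrow>\<^sub>L 'h)" where
  "cfc f X = (THE Y. hs_has_cfc hs_UNIV f (blinfun_apply X) (blinfun_apply Y))"

definition op_powr :: "('h::complex_hilbert \<Rightarrow>\<^sub>L 'h) \<Rightarrow> real \<Rightarrow> ('h \<Rightarrow>\<^sub>L 'h)" where
  "op_powr X q = cfc (\<lambda>t. t powr q) X"

definition op_transfer :: "('h::complex_hilbert \<Rightarrow>\<^sub>L 'h) \<Rightarrow> ('h \<Rightarrow>\<^sub>L 'h) \<Rightarrow> ('h \<Rightarrow>\<^sub>L 'h)" where
  "op_transfer X Y = op_powr X (-1/2) o\<^sub>L Y o\<^sub>L op_powr X (-1/2)"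

definition op_natural :: "real \<Rightarrow> ('h::complex_hilbert \<Rightarrow>\<^sub>L 'h) \<Rightarrow> ('h \<Rightarrow>\<^sub>L 'h) \<Rightarrow> ('h \<Rightarrow>\<^sub>L 'h)" where
  "op_natural q X Y = op_powr X (1/2) o\<^sub>L op_powr (op_transfer X Y) q o\<^sub>L op_powr X (1/2)"

definition op_entropy :: "real \<Rightarrow> (real \<Rightarrow> real) \<Rightarrow>
    ('h::complex_hilbert \<Rightarrow>\<^sub>L 'h) \<Rightarrow> ('h \<Rightarrow>\<^sub>L 'h) \<Rightarrow> ('h \<Rightarrow>\<^sub>L 'h)" where
  "op_entropy q f X Y =
     op_powr X (1/2) o\<^sub>L op_powr (op_transfer X Y) q o\<^sub>L cfc f (op_transfer X Y) o\<^sub>L op_powr X (1/2)"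


section \<open>Integrals of continuous fields of operators\<close>

definition cstar_algebra :: "('h::complex_hilbert \<Rightarrow>\<^sub>L 'h) set \<Rightarrow> bool" where
  "cstar_algebra \<A> \<longleftrightarrow> (\<forall>X\<in>\<A>. clinear_op X) \<and> 0 \<in> \<A> \<and>
     (\<forall>X\<in>\<A>. \<forall>Y\<in>\<A>. X + Y \<in> \<A> \<and> X o\<^sub>L Y \<in> \<A>) \<and>
     (\<forall>c. \<forall>X\<in>\<A>. op_scaleC c X \<in> \<A>) \<and>
     (\<forall>X\<in>\<A>. \<exists>Y\<in>\<A>. \<forall>x y. cinner (X x) y = cinner x (Y y)) \<and>
     closed \<A>"

text \<open>The elements of the dual of \<open>\<A>\<close> are represented by their arbitrary extensions to all operators.\<close>

definition dual_space :: "('h::complex_hilbert \<Rightarrow>\<^sub>L 'h) set \<Rightarrow> (('h \<Rightarrow>\<^sub>L 'h) \<Rightarrow> complex) set" where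
  "dual_space \<A> = {\<phi>.
     (\<forall>X\<in>\<A>. \<forall>Y\<in>\<A>. \<phi> (X + Y) = \<phi> X + \<phi> Y) \<and>
     (\<forall>c. \<forall>X\<in>\<A>. \<phi> (op_scaleC c X) = c * \<phi> X) \<and>
     (\<exists>C. \<forall>X\<in>\<A>. cmod (\<phi> X) \<le> C * norm X)}"

text \<open>
  Radon measures are taken on the Borel sets: finite on compact sets, outer regular on Borel sets
  and inner regular on open sets.
\<close>

definition radon_measure :: "('t::t2_space) measure \<Rightarrow> bool" where
  "radon_measure \<mu> \<longleftrightarrow> sets \<mu> = sets borel \<and>
     (\<forall>C. compact C \<longrightarrow> emeasure \<mu> C < \<infinity>) \<and>
     (\<forall>E\<in>sets borel. emeasure \<mu> E = (INF V\<in>{V. open V \<and> E \<subseteq> V}. emeasure \<mu> V)) \<and>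
     (\<forall>V. open V \<longrightarrow> emeasure \<mu> V = (SUP C\<in>{C. compact C \<and> C \<subseteq> V}. emeasure \<mu> C))"

definition continuous_field :: "('h::complex_hilbert \<Rightarrow>\<^sub>L 'h) set \<Rightarrow> ('t::t2_space) measure \<Rightarrow>
    ('t \<Rightarrow> ('h \<Rightarrow>\<^sub>L 'h)) \<Rightarrow> bool" where
  "continuous_field \<A> \<mu> A \<longleftrightarrow>
     (\<forall>t. A t \<in> \<A>) \<and> continuous_on UNIV A \<and> integrable \<mu> (\<lambda>t. norm (A t))"

definition op_integral :: "('h::complex_hilbert \<Rightarrow>\<^sub>L 'h) set \<Rightarrow> 't measure \<Rightarrow>
    ('t \<Rightarrow> ('h \<Rightarrow>\<^sub>L 'h)) \<Rightarrow> ('h \<Rightarrow>\<^sub>L 'h)" where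
  "op_integral \<A> \<mu> A = (THE Y. Y \<in> \<A> \<and>
     (\<forall>\<phi>\<in>dual_space \<A>. integrable \<mu> (\<lambda>t. \<phi> (A t)) \<and> \<phi> Y = (\<integral>t. \<phi> (A t) \<partial>\<mu>)))"

definition relative_entropy :: "('h::complex_hilbert \<Rightarrow>\<^sub>L 'h) set \<Rightarrow> 't measure \<Rightarrow> real \<Rightarrow>
    (real \<Rightarrow> real) \<Rightarrow> ('t \<Rightarrow> ('h \<Rightarrow>\<^sub>L 'h)) \<Rightarrow> ('t \<Rightarrow> ('h \<Rightarrow>\<^sub>L 'h)) \<Rightarrow> ('h \<Rightarrow>\<^sub>L 'h)" where
  "relative_entropy \<A> \<mu> q f A B = op_integral \<A> \<mu> (\<lambda>s. op_entropy q f (A s) (B s))"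

end

theory Submission
  imports Defs "HOL-Computational_Algebra.Fundamental_Theorem_Algebra"
begin

text \<open>
  For comparable strictly positive \<open>A\<close> and \<open>B\<close> let \<open>X = A\<^sup>-\<^sup>1\<^sup>/\<^sup>2 B A\<^sup>-\<^sup>1\<^sup>/\<^sup>2\<close>, an operator with spectrum in \<open>[m, M]\<close>,
  and call \<open>A\<^sup>1\<^sup>/\<^sup>2 g(X) A\<^sup>1\<^sup>/\<^sup>2\<close> the perspective of a continuous function \<open>g\<close>. Let \<open>\<Phi> g\<close> be the
  integral over \<open>T\<close> of the perspectives of \<open>g\<close> at \<open>(A\<^sub>s, B\<^sub>s)\<close>. The map \<open>\<Phi>\<close> is linear and
  monotone, and since \<open>1\<close> and \<open>t\<close> have the perspectives \<open>A\<close> and \<open>B\<close>, the normalization says that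
  \<open>\<Phi> 1 = \<Phi> t = I\<close>. The operators in the theorem are values of \<open>\<Phi>\<close>: \<open>P = \<Phi> (t\<^sup>p)\<close>,
  \<open>Q = \<Phi> (t\<^sup>p t)\<close> and the entropy \<open>E = \<Phi> (t\<^sup>p f)\<close>.

  From \<open>t\<^sup>p \<le> (1 - p) + p t\<close> follows \<open>P \<le> I\<close>, and from \<open>m t\<^sup>p \<le> t\<^sup>p t \<le> M t\<^sup>p\<close> follows
  \<open>m P \<le> Q \<le> M P\<close>. Hence \<open>Z = Q + t\<^sub>0 (I - P)\<close> also lies between \<open>m I\<close> and \<open>M I\<close>. On \<open>[m, M]\<close>
  the concave \<open>f\<close> lies above its chord \<open>a t + b\<close>, by at most \<open>\<zeta>\<close>. The upper bound gives
  \<open>f(Z) \<le> a Z + b + \<zeta>\<close>. The lower bound gives \<open>a Q + b P \<le> E\<close>, by monotonicity of \<open>\<Phi>\<close>, and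
  \<open>(a t\<^sub>0 + b) (I - P) \<le> f(t\<^sub>0) (I - P)\<close>; the left-hand sides of the last two inequalities add up
  to \<open>a Z + b\<close>. This is \<open>entropy_bound\<close>.

  Two foundations carry the argument. The first is the continuous functional calculus of a
  self-adjoint operator. It rests on \<open>norm_poly_op_le\<close>: the norm of a polynomial in \<open>X\<close> is at most
  its supremum on the spectrum. This is proved by splitting polynomials into linear factors and
  arguing with lower bounds of operators only. The second is the existence of the integral of
  a continuous field with values in a nonseparable algebra (\<open>op_integral_exists\<close>), which is
  obtained from Riemann sums over compact sets. Perspectives of continuous fields are again such
  fields (\<open>continuous_field_perspective\<close>), because the functional calculus is norm continuous.
\<close>


section \<open>Complex inner products\<close>

lemma cinner_add_right: "cinner x (y + z) = cinner x y + cinner x (z::'h::complex_hilbert)"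
  by (metis cinner_add_left cinner_commute complex_cnj_add)

lemma cinner_scaleC_right: "cinner x (scaleC c y) = cnj c * cinner x (y::'h::complex_hilbert)"
  by (metis cinner_commute cinner_scaleC_left complex_cnj_mult)

lemma cinner_scaleR_left: "cinner (r *\<^sub>R x) y = complex_of_real r * cinner x (y::'h::complex_hilbert)"
  by (metis cinner_scaleC_left scaleC_of_real)

lemma cinner_scaleR_right: "cinner x (r *\<^sub>R y) = complex_of_real r * cinner x (y::'h::complex_hilbert)"
  by (metis cinner_scaleC_right scaleC_of_real complex_cnj_complex_of_real)

lemma cinner_minus_left: "cinner (- x) y = - cinner x (y::'h::complex_hilbert)"
  using cinner_scaleR_left[of "-1" x y] by simp

lemma cinner_minus_right: "cinner x (- y) = - cinner x (y::'h::complex_hilbert)"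
  using cinner_scaleR_right[of x "-1" y] by simp

lemma cinner_diff_left: "cinner (x - y) z = cinner x z - cinner y (z::'h::complex_hilbert)"
  using cinner_add_left[of x "-y" z] by (simp add: cinner_minus_left)

lemma cinner_diff_right: "cinner x (y - z) = cinner x y - cinner x (z::'h::complex_hilbert)"
  using cinner_add_right[of x y "-z"] by (simp add: cinner_minus_right)

lemma cinner_zero_left: "cinner 0 (y::'h::complex_hilbert) = 0"
  using cinner_add_left[of 0 0 y] by simp

lemma cinner_zero_right: "cinner (y::'h::complex_hilbert) 0 = 0"
  using cinner_add_right[of y 0 0] by simp

lemmas cinner_simps =
  cinner_add_left cinner_add_right cinner_diff_left cinner_diff_right cinner_minus_left
  cinner_minus_right cinner_scaleR_left cinner_scaleR_right cinner_scaleC_left cinner_scaleC_right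
  cinner_zero_left cinner_zero_right

lemma Re_cinner_self: "Re (cinner x x) = (norm (x::'h::complex_hilbert))\<^sup>2"
proof -
  have "Re (cinner x x) \<ge> 0"
    by (metis norm_eq_sqrt_cinner norm_ge_zero real_sqrt_ge_0_iff)
  then show ?thesis by (simp add: norm_eq_sqrt_cinner)
qed

lemma cinner_self: "cinner x x = complex_of_real ((norm (x::'h::complex_hilbert))\<^sup>2)"
proof -
  have "Im (cinner x x) = - Im (cinner x x)"
    using arg_cong[OF cinner_commute[of x x], of Im] by simp
  then show ?thesis by (simp add: complex_eq_iff Re_cinner_self del: of_real_power)
qed

lemma Re_cinner_commute: "Re (cinner x y) = Re (cinner y (x::'h::complex_hilbert))"
  using arg_cong[OF cinner_commute[of x y], of Re] by simp

lemma norm_add_squared: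
  "(norm (x + y))\<^sup>2 = (norm x)\<^sup>2 + 2 * Re (cinner x y) + (norm (y::'h::complex_hilbert))\<^sup>2"
  using Re_cinner_commute[of x y] by (simp add: cinner_simps flip: Re_cinner_self)

lemma norm_diff_squared:
  "(norm (x - y))\<^sup>2 = (norm x)\<^sup>2 - 2 * Re (cinner x y) + (norm (y::'h::complex_hilbert))\<^sup>2"
  using Re_cinner_commute[of x y] by (simp add: cinner_simps flip: Re_cinner_self)

text \<open>
  The common core of the Cauchy-Schwarz inequalities for the inner product and for the form of a
  positive operator.
\<close>

lemma discriminant_bound:
  fixes a b c :: real
  assumes "\<And>t. 0 \<le> a + 2 * t * b + t\<^sup>2 * c"
  shows "b\<^sup>2 \<le> a * c"
proof (cases "c = 0")
  case True
  have "b = 0"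
  proof (rule ccontr)
    assume "b \<noteq> 0"
    then show False
      using assms[of "- (a + 1) / (2 * b)"] True by (simp add: field_simps)
  qed
  then show ?thesis using True by simp
next
  case False
  have "0 \<le> c"
  proof (rule ccontr)
    assume c: "\<not> 0 \<le> c"
    define t where "t = 1 + \<bar>a\<bar> / \<bar>c\<bar>"
    have "0 \<le> a + t\<^sup>2 * c" using assms[of t] assms[of "-t"] by simp
    moreover have "\<bar>a\<bar> / \<bar>c\<bar> < t\<^sup>2"
    proof -
      have "1 \<le> t" by (simp add: t_def)
      then have "t * 1 \<le> t * t" by (intro mult_left_mono) auto
      then show ?thesis by (simp add: t_def power2_eq_square)
    qed
    then have "\<bar>a\<bar> < t\<^sup>2 * \<bar>c\<bar>" using c by (simp add: divide_simps split: if_splits)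
    ultimately show False using c by (simp add: abs_if split: if_splits)
  qed
  then have c: "c > 0" using False by simp
  have "0 \<le> c * (a + 2 * (- b / c) * b + (- b / c)\<^sup>2 * c)"
    using assms[of "-b/c"] c by (intro mult_nonneg_nonneg) auto
  also have "\<dots> = a * c - b\<^sup>2" using c by (simp add: field_simps power2_eq_square)
  finally show ?thesis by simp
qed

lemma Re_cinner_le_norm: "\<bar>Re (cinner x y)\<bar> \<le> norm x * norm (y::'h::complex_hilbert)"
proof -
  have "(Re (cinner x y))\<^sup>2 \<le> (norm x)\<^sup>2 * (norm y)\<^sup>2"
  proof (rule discriminant_bound)
    fix t :: real
    have "0 \<le> (norm (x + t *\<^sub>R y))\<^sup>2" by simp
    then show "0 \<le> (norm x)\<^sup>2 + 2 * t * Re (cinner x y) + t\<^sup>2 * (norm y)\<^sup>2"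
      by (simp add: norm_add_squared cinner_simps power_mult_distrib)
  qed
  then show ?thesis
    by (metis abs_le_square_iff abs_of_nonneg mult_nonneg_nonneg norm_ge_zero power_mult_distrib)
qed

lemma norm_cinner_le: "cmod (cinner x y) \<le> norm x * norm (y::'h::complex_hilbert)"
proof (cases "cinner x y = 0")
  case False
  \<comment> \<open>the phase that makes the inner product real\<close>
  define u where "u = cnj (cinner x y) / complex_of_real (cmod (cinner x y))"
  have u: "cmod u = 1" using False by (simp add: u_def norm_divide)
  have "u * cinner x y = complex_of_real (cmod (cinner x y))"
    using False by (simp add: u_def complex_norm_square[symmetric] field_simps power2_eq_square)
  then have "cmod (cinner x y) = Re (cinner (scaleC u x) y)"
    by (simp add: cinner_simps)
  also have "\<dots> \<le> norm (scaleC u x) * norm y" using Re_cinner_le_norm abs_le_D1 by blast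
  finally show ?thesis by (simp add: norm_scaleC u)
qed simp

lemma norm_cinner_apply_le:
  fixes X :: "'h::complex_hilbert \<Rightarrow>\<^sub>L 'h"
  shows "cmod (cinner (X x) y) \<le> (norm x * norm y) * norm X"
  using norm_cinner_le[of "X x" y] mult_right_mono[OF norm_blinfun[of X x], of "norm y"]
  by (simp add: mult_ac)

text \<open>
  The choice \<open>y = X x\<close> in the hypothesis bounds \<open>norm (X x)\<close>. This turns weak estimates into norm
  estimates.
\<close>

lemma norm_op_le_if_cinner_le:
  fixes X :: "'h::complex_hilbert \<Rightarrow>\<^sub>L 'h"
  assumes "\<And>x y. cmod (cinner (X x) y) \<le> c * (norm x * norm y)" and "0 \<le> c"
  shows "norm X \<le> c"
proof (rule norm_blinfun_bound[OF assms(2)])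
  fix x
  have "norm (X x) * norm (X x) \<le> (c * norm x) * norm (X x)"
    using assms(1)[of x "X x"]
    by (simp add: cinner_self power2_eq_square mult.assoc flip: of_real_mult)
  then show "norm (X x) \<le> c * norm x"
    by (cases "X x = 0") (auto simp: assms(2))
qed

lemma op_eq_if_cinner_eq:
  fixes X Y :: "'h::complex_hilbert \<Rightarrow>\<^sub>L 'h"
  assumes "\<And>x y. cinner (X x) y = cinner (Y x) y"
  shows "X = Y"
proof -
  have "norm (X - Y) \<le> 0"
    by (rule norm_op_le_if_cinner_le) (auto simp: blinfun.bilinear_simps cinner_simps assms)
  then show ?thesis by simp
qed


section \<open>Self-adjoint operators and their quadratic forms\<close>

definition self_adjoint :: "('h::complex_hilbert \<Rightarrow>\<^sub>L 'h) \<Rightarrow> bool" where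
  "self_adjoint X \<longleftrightarrow> (\<forall>x y. cinner (X x) y = cinner x (X y))"

definition quad :: "('h::complex_hilbert \<Rightarrow>\<^sub>L 'h) \<Rightarrow> 'h \<Rightarrow> real" where
  "quad X x = Re (cinner (X x) x)"

text \<open>
  Symmetry moves \<open>X\<close> to the other side of the inner product, through which scalars pass.
\<close>

lemma self_adjoint_clinear:
  assumes "self_adjoint X" shows "clinear_op X"
  unfolding clinear_op_def
proof safe
  fix c x
  let ?d = "X (scaleC c x) - scaleC c (X x)"
  have "cinner ?d y = 0" for y
    using assms by (simp add: self_adjoint_def cinner_simps)
  then have "Re (cinner ?d ?d) = 0" by (metis zero_complex.sel(1))
  then show "X (scaleC c x) = scaleC c (X x)" by (simp add: Re_cinner_self)
qed

lemma hs_operator_UNIV_iff: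
  "hs_operator hs_UNIV (blinfun_apply X) \<longleftrightarrow> clinear_op (X::'h::complex_hilbert \<Rightarrow>\<^sub>L 'h)"
proof -
  have "\<exists>C. \<forall>x. norm (X x) \<le> C * norm x" using norm_blinfun by blast
  then show ?thesis
    by (simp add: hs_operator_def hs_norm_UNIV clinear_op_def blinfun.add_right)
      (simp add: hs_UNIV_def)
qed

lemma hs_selfadjoint_UNIV_iff:
  "hs_selfadjoint hs_UNIV (blinfun_apply X) \<longleftrightarrow> self_adjoint (X::'h::complex_hilbert \<Rightarrow>\<^sub>L 'h)"
  unfolding hs_selfadjoint_def hs_operator_UNIV_iff self_adjoint_def
  using self_adjoint_clinear[of X] by (auto simp: hs_UNIV_def self_adjoint_def)

lemma op_le_iff:
  "X \<preceq>\<^sub>L Y \<longleftrightarrow> self_adjoint X \<and> self_adjoint Y \<and> (\<forall>x. quad X x \<le> quad Y x)"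
  by (simp add: op_le_def hs_le_def hs_selfadjoint_UNIV_iff quad_def) (simp add: hs_UNIV_def)

lemma self_adjoint_simps [simp, intro]:
  "self_adjoint 0" "self_adjoint id_blinfun"
  "self_adjoint X \<Longrightarrow> self_adjoint Y \<Longrightarrow> self_adjoint (X + Y)"
  "self_adjoint X \<Longrightarrow> self_adjoint Y \<Longrightarrow> self_adjoint (X - Y)"
  "self_adjoint X \<Longrightarrow> self_adjoint (r *\<^sub>R X)"
  by (auto simp: self_adjoint_def blinfun.bilinear_simps cinner_simps)

lemma self_adjoint_sandwich [intro]:
  "self_adjoint S \<Longrightarrow> self_adjoint X \<Longrightarrow> self_adjoint (S o\<^sub>L X o\<^sub>L S)"
  by (simp add: self_adjoint_def)

lemma quad_simps [simp]:
  "quad 0 x = 0" "quad id_blinfun x = (norm x)\<^sup>2"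
  "quad (X + Y) x = quad X x + quad Y x" "quad (X - Y) x = quad X x - quad Y x"
  "quad (r *\<^sub>R X) x = r * quad X x"
  by (auto simp: quad_def blinfun.bilinear_simps cinner_simps Re_cinner_self)

lemma quad_sandwich: "self_adjoint S \<Longrightarrow> quad (S o\<^sub>L X o\<^sub>L S) x = quad X (S x)"
  by (simp add: quad_def self_adjoint_def)

lemma quad_square: "self_adjoint S \<Longrightarrow> quad (S o\<^sub>L S) x = (norm (S x))\<^sup>2"
  by (simp add: quad_def self_adjoint_def flip: Re_cinner_self)

lemma abs_quad_le: "\<bar>quad X x\<bar> \<le> norm X * (norm x)\<^sup>2"
proof -
  have "\<bar>quad X x\<bar> \<le> norm (X x) * norm x" by (simp add: quad_def Re_cinner_le_norm)
  also have "\<dots> \<le> norm X * norm x * norm x" by (intro mult_right_mono norm_blinfun) auto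
  finally show ?thesis by (simp add: power2_eq_square mult.assoc)
qed

text \<open>
  For symmetric \<open>X\<close>, by polarization, the quadratic form controls \<open>Re (cinner (X x) y)\<close>; choosing \<open>y\<close> in the direction
  of \<open>X x\<close>, with the length of \<open>x\<close>, bounds the norm.
\<close>

lemma self_adjoint_norm_le:
  assumes X: "self_adjoint X" and q: "\<And>x. \<bar>quad X x\<bar> \<le> c * (norm x)\<^sup>2" and c: "0 \<le> c"
  shows "norm X \<le> c"
proof (rule norm_blinfun_bound[OF c])
  fix x
  show "norm (X x) \<le> c * norm x"
  proof (cases "X x = 0 \<or> x = 0")
    case False
    define y where "y = (norm x / norm (X x)) *\<^sub>R X x"
    have ny: "norm y = norm x" using False by (simp add: y_def)
    have "Re (cinner (X y) x) = Re (cinner (X x) y)"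
      using X Re_cinner_commute[of "X y" x] by (simp add: self_adjoint_def)
    then have "4 * Re (cinner (X x) y) = quad X (x + y) - quad X (x - y)"
      by (simp add: quad_def blinfun.bilinear_simps cinner_simps)
    also have "\<dots> \<le> c * (norm (x + y))\<^sup>2 + c * (norm (x - y))\<^sup>2"
      using q[of "x + y"] q[of "x - y"] by linarith
    also have "\<dots> = 4 * (c * (norm x)\<^sup>2)"
      by (simp add: norm_add_squared norm_diff_squared ny algebra_simps)
    finally have "Re (cinner (X x) y) \<le> c * (norm x)\<^sup>2" by simp
    moreover have "Re (cinner (X x) y) = norm x * norm (X x)"
      using False by (simp add: y_def cinner_simps Re_cinner_self power2_eq_square)
    ultimately show ?thesis using False by (simp add: power2_eq_square)
  qed (auto simp: c)
qed

lemma positive_Cauchy_Schwarz: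
  assumes X: "self_adjoint X" and q: "\<And>x. 0 \<le> quad X x"
  shows "(Re (cinner (X x) y))\<^sup>2 \<le> quad X x * quad X y"
proof (rule discriminant_bound)
  fix t :: real
  have "Re (cinner (X y) x) = Re (cinner (X x) y)"
    using X Re_cinner_commute[of "X y" x] by (simp add: self_adjoint_def)
  then have "quad X (x + t *\<^sub>R y) = quad X x + 2 * t * Re (cinner (X x) y) + t\<^sup>2 * quad X y"
    by (simp add: quad_def blinfun.bilinear_simps cinner_simps power2_eq_square algebra_simps)
  then show "0 \<le> quad X x + 2 * t * Re (cinner (X x) y) + t\<^sup>2 * quad X y"
    using q[of "x + t *\<^sub>R y"] by simp
qed

text \<open>
  Positivity gives \<open>norm (A x)\<^sup>2 \<le> norm A * quad A x\<close>, and invertibility bounds \<open>norm (A x)\<close>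
  below.
\<close>

lemma strictly_positive_bounded_below:
  assumes "strictly_positive (A::'h::complex_hilbert \<Rightarrow>\<^sub>L 'h)"
  obtains c where "0 < c" "self_adjoint A" "\<And>x. c * (norm x)\<^sup>2 \<le> quad A x"
proof -
  obtain Y where A: "self_adjoint A" "\<And>x. 0 \<le> quad A x" and Y: "Y o\<^sub>L A = id_blinfun"
    using assms unfolding strictly_positive_def op_le_iff by auto
  define d where "d = (norm Y + 1)\<^sup>2 * (norm A + 1)"
  have d: "0 < d" unfolding d_def by (intro mult_pos_pos zero_less_power add_nonneg_pos) auto
  have "(norm x)\<^sup>2 \<le> d * quad A x" for x
  proof (cases "A x = 0")
    case True
    have "x = Y (A x)" using Y by (metis blinfun_apply_id_blinfun blinfun_apply_blinfun_compose)
    then have "x = 0" using True by simp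
    then show ?thesis by (simp add: quad_def cinner_simps)
  next
    case False
    have "x = Y (A x)" using Y by (metis blinfun_apply_id_blinfun blinfun_apply_blinfun_compose)
    then have "norm x \<le> norm Y * norm (A x)" by (metis norm_blinfun)
    also have "\<dots> \<le> (norm Y + 1) * norm (A x)" by (intro mult_right_mono) auto
    finally have 1: "(norm x)\<^sup>2 \<le> (norm Y + 1)\<^sup>2 * (norm (A x))\<^sup>2"
      by (metis norm_ge_zero power_mono power_mult_distrib)
    have "(norm (A x))\<^sup>2 * (norm (A x))\<^sup>2 = (Re (cinner (A x) (A x)))\<^sup>2"
      by (simp add: Re_cinner_self power2_eq_square)
    also have "\<dots> \<le> quad A x * quad A (A x)" by (rule positive_Cauchy_Schwarz[OF A])
    also have "\<dots> \<le> quad A x * (norm A * (norm (A x))\<^sup>2)"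
      using abs_quad_le[of A "A x"] A(2) by (intro mult_left_mono) auto
    finally have "(norm (A x))\<^sup>2 * (norm (A x))\<^sup>2 \<le> (quad A x * norm A) * (norm (A x))\<^sup>2"
      by (simp only: mult.assoc)
    then have "(norm (A x))\<^sup>2 \<le> quad A x * norm A"
      using False by (subst (asm) mult_le_cancel_right) simp
    also have "\<dots> \<le> quad A x * (norm A + 1)" using A(2) by (intro mult_left_mono) auto
    finally have "(norm Y + 1)\<^sup>2 * (norm (A x))\<^sup>2 \<le> (norm Y + 1)\<^sup>2 * (quad A x * (norm A + 1))"
      by (intro mult_left_mono) auto
    then show ?thesis using 1 by (simp add: d_def mult_ac)
  qed
  then have "1 / d * (norm x)\<^sup>2 \<le> quad A x" for x using d by (simp add: field_simps)
  then show thesis using that[of "1 / d"] d A by simp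
qed



section \<open>Polynomials of a self-adjoint operator\<close>

definition poly_op :: "('h::complex_hilbert \<Rightarrow>\<^sub>L 'h) \<Rightarrow> real poly \<Rightarrow> ('h \<Rightarrow>\<^sub>L 'h)" where
  "poly_op X P = fold_coeffs (\<lambda>a T. a *\<^sub>R id_blinfun + (X o\<^sub>L T)) P 0"

lemma poly_op_0 [simp]: "poly_op X 0 = 0"
  by (simp add: poly_op_def)

lemma blinfun_compose_simps:
  fixes X Y Z :: "'a::real_normed_vector \<Rightarrow>\<^sub>L 'a"
  shows "X o\<^sub>L 0 = 0"
  "X o\<^sub>L (Y + Z) = (X o\<^sub>L Y) + (X o\<^sub>L Z)"
  "(X + Y) o\<^sub>L Z = (X o\<^sub>L Z) + (Y o\<^sub>L Z)"
  "X o\<^sub>L (Y - Z) = (X o\<^sub>L Y) - (X o\<^sub>L Z)"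
  "(X - Y) o\<^sub>L Z = (X o\<^sub>L Z) - (Y o\<^sub>L Z)"
  "X o\<^sub>L (r *\<^sub>R Y) = r *\<^sub>R (X o\<^sub>L Y)"
  "(r *\<^sub>R X) o\<^sub>L Y = r *\<^sub>R (X o\<^sub>L Y)"
  "X o\<^sub>L id_blinfun = X" "id_blinfun o\<^sub>L Y = Y"
  by (auto intro!: blinfun_eqI simp: blinfun.bilinear_simps)

lemma poly_op_pCons [simp]: "poly_op X (pCons a P) = a *\<^sub>R id_blinfun + (X o\<^sub>L poly_op X P)"
  by (cases "P = 0 \<and> a = 0") (auto simp: poly_op_def blinfun_compose_simps)

lemma poly_op_add: "poly_op X (P + Q) = poly_op X P + poly_op X Q"
  by (induction P Q rule: poly_induct2) (simp_all add: blinfun_compose_simps scaleR_add_left)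

lemma poly_op_smult: "poly_op X (smult r P) = r *\<^sub>R poly_op X P"
  by (induction P) (simp_all add: blinfun_compose_simps scaleR_add_right)

lemma poly_op_diff: "poly_op X (P - Q) = poly_op X P - poly_op X Q"
  using poly_op_add[of X P "smult (-1) Q"] by (simp only: poly_op_smult) simp

lemma poly_op_mult: "poly_op X (P * Q) = poly_op X P o\<^sub>L poly_op X Q"
  by (induction P)
    (auto intro!: blinfun_eqI
      simp: blinfun_compose_simps poly_op_add poly_op_smult blinfun.bilinear_simps)

lemma poly_op_commute: "X o\<^sub>L poly_op X P = poly_op X P o\<^sub>L X"
  using poly_op_mult[of X "[:0, 1:]" P] poly_op_mult[of X P "[:0, 1:]"]
  by (simp add: blinfun_compose_simps mult.commute)

lemma self_adjoint_poly_op: "self_adjoint X \<Longrightarrow> self_adjoint (poly_op X P)"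
proof (induction P)
  case (pCons a P)
  have "self_adjoint (X o\<^sub>L poly_op X P)"
    unfolding self_adjoint_def
  proof safe
    fix x y
    have "cinner ((X o\<^sub>L poly_op X P) x) y = cinner x ((poly_op X P o\<^sub>L X) y)"
      using pCons by (simp add: self_adjoint_def)
    then show "cinner ((X o\<^sub>L poly_op X P) x) y = cinner x ((X o\<^sub>L poly_op X P) y)"
      by (simp only: poly_op_commute)
  qed
  then show ?case by simp
qed simp

text \<open>
  Complex coefficients are needed to split a polynomial into linear factors. Their evaluation is
  defined by the formula of \<open>hs_poly\<close>, so that it specializes to it.
\<close>

definition cpoly_apply :: "('h::complex_hilbert \<Rightarrow>\<^sub>L 'h) \<Rightarrow> complex poly \<Rightarrow> 'h \<Rightarrow> 'h" where
  "cpoly_apply X p x = (\<Sum>i\<le>degree p. scaleC (coeff p i) ((blinfun_apply X ^^ i) x))"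

lemma scaleC_zero_left [simp]: "scaleC 0 (x::'h::complex_hilbert) = 0"
  using scaleC_of_real[of 0 x] by simp

lemma scaleC_one [simp]: "scaleC 1 (x::'h::complex_hilbert) = x"
  using scaleC_of_real[of 1 x] by simp

lemma scaleC_minus_left: "scaleC (- c) (x::'h::complex_hilbert) = - scaleC c x"
  using scaleC_add_left[of c "-c" x] by (simp add: eq_neg_iff_add_eq_0 add.commute)

lemma scaleC_zero_right [simp]: "scaleC c (0::'h::complex_hilbert) = 0"
  using scaleC_add_right[of c 0 0] by simp

lemma cpoly_apply_0 [simp]: "cpoly_apply X 0 x = 0"
  by (simp add: cpoly_apply_def)

lemma cpoly_apply_pCons:
  assumes "clinear_op X"
  shows "cpoly_apply X (pCons a p) x = scaleC a x + X (cpoly_apply X p x)"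
proof (cases "p = 0")
  case False
  have "X (cpoly_apply X p x)
      = (\<Sum>i\<le>degree p. scaleC (coeff p i) ((blinfun_apply X ^^ Suc i) x))"
    using assms by (simp add: cpoly_apply_def blinfun.sum_right clinear_op_def)
  moreover have "cpoly_apply X (pCons a p) x
      = (\<Sum>i\<le>Suc (degree p). scaleC (coeff (pCons a p) i) ((blinfun_apply X ^^ i) x))"
    using False by (simp add: cpoly_apply_def)
  ultimately show ?thesis
    by (simp only: sum.atMost_Suc_shift) simp
qed (simp add: cpoly_apply_def)

lemma cpoly_apply_add:
  assumes "clinear_op X"
  shows "cpoly_apply X (p + q) x = cpoly_apply X p x + cpoly_apply X q x"
  by (induction p q rule: poly_induct2)
    (simp_all add: cpoly_apply_pCons[OF assms] scaleC_add_left blinfun.bilinear_simps)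

lemma cpoly_apply_smult:
  assumes "clinear_op X"
  shows "cpoly_apply X (smult c p) x = scaleC c (cpoly_apply X p x)"
  using assms by (induction p) (simp_all add: cpoly_apply_pCons[OF assms] scaleC_add_right
    scaleC_scaleC clinear_op_def)

lemma cpoly_apply_linear_factor:
  assumes "clinear_op X"
  shows "cpoly_apply X ([:- z, 1:] * p) x
    = X (cpoly_apply X p x) - scaleC z (cpoly_apply X p x)"
proof -
  have "[:- z, 1:] * p = pCons 0 p + smult (- z) p" by simp
  then show ?thesis
    by (simp only: cpoly_apply_add[OF assms] cpoly_apply_smult[OF assms] cpoly_apply_pCons[OF assms]
      scaleC_minus_left) simp
qed

lemma cpoly_apply_of_real:
  assumes "clinear_op X"
  shows "cpoly_apply X (map_poly complex_of_real P) x = poly_op X P x"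
  by (induction P) (simp_all add: map_poly_pCons cpoly_apply_pCons[OF assms] scaleC_of_real
    blinfun.bilinear_simps)

lemma hs_poly_UNIV:
  assumes "clinear_op X"
  shows "hs_poly hs_UNIV P (blinfun_apply X) x = poly_op X P x"
  unfolding cpoly_apply_of_real[OF assms, symmetric] cpoly_apply_def hs_poly_def
  by (simp add: hs_UNIV_def coeff_map_poly degree_map_poly)

lemma poly_map_poly_of_real:
  "poly (map_poly complex_of_real P) (complex_of_real t) = complex_of_real (poly P t)"
  by (induction P) (simp_all add: map_poly_pCons)

definition bounded_below :: "('h::real_normed_vector \<Rightarrow> 'h) \<Rightarrow> bool" where
  "bounded_below T \<longleftrightarrow> (\<exists>c>0. \<forall>x. c * norm x \<le> norm (T x))"

lemma bounded_below_compose: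
  assumes "bounded_below S" "bounded_below T"
  shows "bounded_below (\<lambda>x. S (T x))"
proof -
  obtain c d where c: "c > 0" "\<And>x. c * norm x \<le> norm (S x)"
    and d: "d > 0" "\<And>x. d * norm x \<le> norm (T x)"
    using assms unfolding bounded_below_def by blast
  have "(c * d) * norm x \<le> norm (S (T x))" for x
  proof -
    have "c * (d * norm x) \<le> c * norm (T x)" using c d by (intro mult_left_mono) auto
    also have "\<dots> \<le> norm (S (T x))" by (rule c)
    finally show ?thesis by (simp add: mult.assoc)
  qed
  then show ?thesis unfolding bounded_below_def using c d by (intro exI[of _ "c * d"]) auto
qed

text \<open>
  Splitting \<open>p\<close> into linear factors makes \<open>p(X)\<close> a composition of operators \<open>X - z\<close> with \<open>z\<close> a
  root. Lower bounds compose and, unlike invertibility, do not involve surjectivity; this suffices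
  for the part of the spectral mapping theorem needed below.
\<close>

lemma bounded_below_cpoly:
  assumes X: "clinear_op X" and "p \<noteq> 0"
    and "\<And>z. poly p z = 0 \<Longrightarrow> bounded_below (\<lambda>x. X x - scaleC z x)"
  shows "bounded_below (cpoly_apply X p)"
  using assms(2,3)
proof (induction "degree p" arbitrary: p)
  case 0
  then obtain a where "p = [:a:]" "a \<noteq> 0" by (metis degree_eq_zeroE pCons_eq_0_iff)
  then show ?case unfolding bounded_below_def
    by (intro exI[of _ "cmod a"]) (simp add: cpoly_apply_def norm_scaleC)
next
  case (Suc n)
  then have "\<not> constant (poly p)" 
    by (metis Zero_not_Suc constant_degree)
  then obtain z where z: "poly p z = 0" using fundamental_theorem_of_algebra by blast
  then obtain q where q: "p = [:- z, 1:] * q" using poly_eq_0_iff_dvd by (metis dvdE)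
  have q0: "q \<noteq> 0" using q Suc.prems(1) by auto
  have "degree p = Suc (degree q)" using q0 unfolding q by (subst degree_mult_eq) auto
  moreover have "bounded_below (\<lambda>x. X x - scaleC w x)" if "poly q w = 0" for w
    using that q by (intro Suc.prems(2)) auto
  ultimately have "bounded_below (cpoly_apply X q)" using Suc.hyps q0 by auto
  then have "bounded_below (\<lambda>x. X (cpoly_apply X q x) - scaleC z (cpoly_apply X q x))"
    using bounded_below_compose[of "\<lambda>x. X x - scaleC z x"] Suc.prems(2)[OF z] by blast
  then show ?case unfolding bounded_below_def q cpoly_apply_linear_factor[OF X] .
qed

text \<open>
  For self-adjoint \<open>X\<close> the number \<open>cinner (X x) x\<close> is real, so \<open>cinner (X x - z x) x\<close> has the
  imaginary part \<open>- Im z * (norm x)\<^sup>2\<close>.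
\<close>

lemma bounded_below_nonreal:
  assumes X: "self_adjoint X" and z: "Im z \<noteq> 0"
  shows "bounded_below (\<lambda>x. X x - scaleC z x)"
proof -
  have "\<bar>Im z\<bar> * norm x \<le> norm (X x - scaleC z x)" for x
  proof -
    have "Im (cinner (X x) x) = 0"
      using X arg_cong[OF cinner_commute[of "X x" x], of Im] by (simp add: self_adjoint_def)
    then have "Im (cinner (X x - scaleC z x) x) = - Im z * (norm x)\<^sup>2"
      by (simp add: cinner_simps cinner_self del: of_real_power)
    then have "\<bar>Im z\<bar> * (norm x)\<^sup>2 = \<bar>Im (cinner (X x - scaleC z x) x)\<bar>"
      by (simp add: abs_mult)
    also have "\<dots> \<le> norm (X x - scaleC z x) * norm x"
      using abs_Im_le_cmod norm_cinner_le order_trans by blast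
    finally show ?thesis by (cases "x = 0") (auto simp: power2_eq_square)
  qed
  then show ?thesis unfolding bounded_below_def using z by (intro exI[of _ "\<bar>Im z\<bar>"]) auto
qed

abbreviation real_spectrum :: "('h::complex_hilbert \<Rightarrow>\<^sub>L 'h) \<Rightarrow> real set" where
  "real_spectrum X \<equiv> {t. complex_of_real t \<in> hs_spectrum hs_UNIV (blinfun_apply X)}"

lemma bounded_below_off_spectrum:
  assumes "z \<notin> hs_spectrum hs_UNIV (blinfun_apply (X::'h::complex_hilbert \<Rightarrow>\<^sub>L 'h))"
  shows "bounded_below (\<lambda>x. X x - scaleC z x)"
proof -
  obtain Y :: "'h \<Rightarrow> 'h" where Y: "hs_operator hs_UNIV Y" "\<And>x. Y (X x - scaleC z x) = x"
    using assms unfolding hs_spectrum_def by (auto simp: hs_UNIV_def)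
  then obtain C where C: "\<And>x. norm (Y x) \<le> C * norm x"
    unfolding hs_operator_def hs_norm_UNIV by (auto simp: hs_UNIV_def)
  have "1 / (\<bar>C\<bar> + 1) * norm x \<le> norm (X x - scaleC z x)" for x
  proof -
    have "norm x \<le> C * norm (X x - scaleC z x)" using C Y(2) by metis
    also have "\<dots> \<le> (\<bar>C\<bar> + 1) * norm (X x - scaleC z x)" by (intro mult_right_mono) auto
    finally show ?thesis by (simp add: field_simps)
  qed
  moreover have "1 / (\<bar>C\<bar> + 1) > 0" by simp
  ultimately show ?thesis unfolding bounded_below_def by blast
qed

text \<open>
  A root off the real axis or off the spectrum contributes a linear factor that is bounded below.
\<close>

lemma poly_root_in_spectrum:
  assumes X: "self_adjoint X" and P: "P \<noteq> 0" and nb: "\<not> bounded_below (poly_op X P)"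
  obtains t where "t \<in> real_spectrum X" "poly P t = 0"
proof -
  let ?p = "map_poly complex_of_real P"
  have cl: "clinear_op X" by (rule self_adjoint_clinear[OF X])
  have "?p \<noteq> 0" using P by (simp add: map_poly_eq_0_iff)
  moreover have "\<not> bounded_below (cpoly_apply X ?p)"
    using nb cpoly_apply_of_real[OF cl] by (simp add: bounded_below_def)
  ultimately obtain z where z: "poly ?p z = 0" "\<not> bounded_below (\<lambda>x. X x - scaleC z x)"
    using bounded_below_cpoly[OF cl] by blast
  have "Im z = 0" using bounded_below_nonreal[OF X] z by blast
  then have r: "z = complex_of_real (Re z)" by (simp add: complex_eq_iff)
  have "poly P (Re z) = 0"
    using z(1) poly_map_poly_of_real[of P "Re z"] r by (metis of_real_eq_0_iff)
  moreover have "Re z \<in> real_spectrum X"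
    using bounded_below_off_spectrum[of z X] z(2) r by auto
  ultimately show thesis using that by blast
qed

text \<open>
  The inequality \<open>norm ((S\<^sup>2 - N\<^sup>2) x)\<^sup>2 \<le> N\<^sup>2 * (N\<^sup>2 * (norm x)\<^sup>2 - (norm (S x))\<^sup>2)\<close> with \<open>N = norm S\<close>
  shows that a lower bound for \<open>S\<^sup>2 - N\<^sup>2\<close> would make the norm of \<open>S\<close> smaller than \<open>N\<close>.
\<close>

lemma not_bounded_below_square_minus_norm:
  fixes S :: "'h::complex_hilbert \<Rightarrow>\<^sub>L 'h"
  assumes S: "self_adjoint S" and nz: "S \<noteq> 0"
  shows "\<not> bounded_below (\<lambda>x. (S o\<^sub>L S) x - (norm S)\<^sup>2 *\<^sub>R x)"
proof
  define N where "N = norm S"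
  have N: "N > 0" using nz by (simp add: N_def)
  assume "bounded_below (\<lambda>x. (S o\<^sub>L S) x - (norm S)\<^sup>2 *\<^sub>R x)"
  then obtain c where c: "c > 0" and cb: "\<And>x. c * norm x \<le> norm (S (S x) - N\<^sup>2 *\<^sub>R x)"
    unfolding bounded_below_def N_def by auto
  have ineq: "(norm (S x))\<^sup>2 \<le> (N\<^sup>2 - c\<^sup>2 / N\<^sup>2) * (norm x)\<^sup>2" for x
  proof -
    have "(c * norm x)\<^sup>2 \<le> (norm (S (S x) - N\<^sup>2 *\<^sub>R x))\<^sup>2"
      using cb c by (intro power_mono) auto
    also have "\<dots> = (norm (S (S x)))\<^sup>2 - 2 * N\<^sup>2 * (norm (S x))\<^sup>2 + N\<^sup>2 * N\<^sup>2 * (norm x)\<^sup>2"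
    proof -
      have "Re (cinner (S (S x)) x) = (norm (S x))\<^sup>2"
        using S by (metis Re_cinner_self self_adjoint_def)
      then show ?thesis
        unfolding norm_diff_squared
        by (simp add: cinner_scaleR_right power_mult_distrib power2_eq_square del: of_real_power)
    qed
    also have "\<dots> \<le> N\<^sup>2 * (norm (S x))\<^sup>2 - 2 * N\<^sup>2 * (norm (S x))\<^sup>2 + N\<^sup>2 * N\<^sup>2 * (norm x)\<^sup>2"
      using power_mono[OF norm_blinfun[of S "S x"], of 2] by (simp add: N_def power_mult_distrib)
    finally have "N\<^sup>2 * (norm (S x))\<^sup>2 \<le> (N\<^sup>2 * N\<^sup>2 - c\<^sup>2) * (norm x)\<^sup>2"
      by (simp add: algebra_simps power_mult_distrib)
    then have "(norm (S x))\<^sup>2 \<le> (N\<^sup>2 * N\<^sup>2 - c\<^sup>2) * (norm x)\<^sup>2 / N\<^sup>2"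
      using N by (simp add: pos_le_divide_eq mult.commute)
    also have "\<dots> = (N\<^sup>2 - c\<^sup>2 / N\<^sup>2) * (norm x)\<^sup>2" using N by (simp add: field_simps)
    finally show ?thesis .
  qed
  \<comment> \<open>the maximum keeps the square root meaningful without knowing the sign of the difference\<close>
  define r where "r = max 0 (N\<^sup>2 - c\<^sup>2 / N\<^sup>2)"
  have "norm S \<le> sqrt r"
  proof (rule norm_blinfun_bound)
    fix x
    have "(norm (S x))\<^sup>2 \<le> r * (norm x)\<^sup>2"
      using ineq[of x] by (rule order_trans) (auto simp: r_def intro: mult_right_mono)
    then have "norm (S x) \<le> sqrt (r * (norm x)\<^sup>2)" by (simp add: real_le_rsqrt)
    then show "norm (S x) \<le> sqrt r * norm x" by (simp add: real_sqrt_mult)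
  qed (simp add: r_def)
  moreover have "r < N\<^sup>2" using N c by (simp add: r_def)
  then have "sqrt r < N" using N real_less_lsqrt by (simp add: real_less_lsqrt r_def)
  ultimately show False by (simp add: N_def)
qed

text \<open>
  With \<open>N = norm (P X)\<close> the polynomial \<open>P\<^sup>2 - N\<^sup>2\<close> has a root in the spectrum, at which \<open>P\<close>
  takes the value \<open>N\<close> or \<open>- N\<close>. If that polynomial is zero, every point of the spectrum serves.
  The spectrum is nonempty: for \<open>X \<noteq> 0\<close> by the same argument applied to the polynomial \<open>t\<close>, and for
  \<open>X = 0\<close> because the zero operator is not bounded below on a nonzero space.
\<close>

lemma norm_poly_op_attained:
  fixes X :: "'h::complex_hilbert \<Rightarrow>\<^sub>L 'h"
  assumes X: "self_adjoint X" and nz: "poly_op X P \<noteq> 0"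
  obtains t where "t \<in> real_spectrum X" "\<bar>poly P t\<bar> = norm (poly_op X P)"
proof -
  let ?N = "norm (poly_op X P)"
  have key: "\<exists>t\<in>real_spectrum X. (poly Q t)\<^sup>2 = (norm (poly_op X Q))\<^sup>2"
    if "poly_op X Q \<noteq> 0" "Q * Q - [:(norm (poly_op X Q))\<^sup>2:] \<noteq> 0" for Q
  proof -
    have "poly_op X (Q * Q - [:(norm (poly_op X Q))\<^sup>2:]) x
        = (poly_op X Q o\<^sub>L poly_op X Q) x - (norm (poly_op X Q))\<^sup>2 *\<^sub>R x" for x
      by (simp add: poly_op_diff poly_op_mult blinfun.bilinear_simps blinfun_compose_simps)
    then have "blinfun_apply (poly_op X (Q * Q - [:(norm (poly_op X Q))\<^sup>2:]))
        = (\<lambda>x. (poly_op X Q o\<^sub>L poly_op X Q) x - (norm (poly_op X Q))\<^sup>2 *\<^sub>R x)"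
      by (rule ext)
    then have nb: "\<not> bounded_below (poly_op X (Q * Q - [:(norm (poly_op X Q))\<^sup>2:]))"
      using not_bounded_below_square_minus_norm[OF self_adjoint_poly_op[OF X] that(1)] by metis
    from poly_root_in_spectrum[OF X that(2) nb] show ?thesis
      by (auto simp: power2_eq_square)
  qed
  have "\<exists>t\<in>real_spectrum X. (poly P t)\<^sup>2 = ?N\<^sup>2"
  proof (cases "P * P - [:?N\<^sup>2:] = 0")
    case False
    then show ?thesis using key nz by blast
  next
    case True
    have all: "(poly P t)\<^sup>2 = ?N\<^sup>2" for t
      using arg_cong[OF True, of "\<lambda>p. poly p t"] by (simp add: power2_eq_square)
    have "\<exists>t. t \<in> real_spectrum X"
    proof (cases "X = 0")
      case True
      have nb: "\<not> bounded_below (poly_op X [:0, 1:])"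
      proof
        assume "bounded_below (poly_op X [:0, 1:])"
        then obtain c where "c > 0" "\<And>x::'h. c * norm x \<le> 0"
          using True unfolding bounded_below_def by (auto simp: blinfun_compose_simps)
        then have "x = 0" for x :: 'h by (metis mult_le_0_iff norm_le_zero_iff not_less)
        then have "poly_op X P = 0" by (intro blinfun_eqI) metis
        then show False using nz by simp
      qed
      obtain t where "t \<in> real_spectrum X"
        by (rule poly_root_in_spectrum[OF X _ nb]) simp
      then show ?thesis ..
    next
      case False
      have "poly_op X [:0, 1:] = X" by (simp add: blinfun_compose_simps)
      moreover have "[:0, 1:] * [:0, 1:] - [:(norm X)\<^sup>2:] \<noteq> 0" by simp
      ultimately show ?thesis using key[of "[:0, 1:]"] False by metis
    qed
    then show ?thesis using all by blast
  qed
  then obtain t where "t \<in> real_spectrum X" "\<bar>poly P t\<bar>\<^sup>2 = ?N\<^sup>2" by auto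
  then show thesis using that power2_eq_imp_eq by fastforce
qed

text \<open>
  This estimate makes the functional calculus well defined: polynomials that are uniformly close on
  the spectrum have values that are close in norm.
\<close>

lemma norm_poly_op_le:
  assumes "self_adjoint X" and "\<And>t. t \<in> real_spectrum X \<Longrightarrow> \<bar>poly P t\<bar> \<le> e" and "0 \<le> e"
  shows "norm (poly_op X P) \<le> e"
  using norm_poly_op_attained[OF assms(1), of P] assms(2,3) by (metis norm_zero)



section \<open>The spectrum of an operator between two multiples of the identity\<close>

definition op_between :: "real \<Rightarrow> real \<Rightarrow> ('h::complex_hilbert \<Rightarrow>\<^sub>L 'h) \<Rightarrow> bool" where
  "op_between a b X \<longleftrightarrow> self_adjoint X \<and> (\<forall>x. a * (norm x)\<^sup>2 \<le> quad X x \<and> quad X x \<le> b * (norm x)\<^sup>2)"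

text \<open>
  For a number \<open>d > norm Y\<close> the operator \<open>1 - Y/d\<close> has its form between \<open>0\<close> and \<open>1 - c/d\<close>, so
  \<open>x \<mapsto> x - (Y x - y)/d\<close> is a contraction; its fixed point solves \<open>Y x = y\<close>.
\<close>

lemma invertible_if_quad_bounded_below:
  fixes Y :: "'h::complex_hilbert \<Rightarrow>\<^sub>L 'h"
  assumes Y: "self_adjoint Y" and c: "0 < c" and q: "\<And>x. c * (norm x)\<^sup>2 \<le> quad Y x"
  obtains Z where "hs_operator hs_UNIV Z" "\<And>x. Z (Y x) = x" "\<And>x. Y (Z x) = x"
proof -
  have low: "c * norm x \<le> norm (Y x)" for x
  proof (cases "x = 0")
    case False
    have "c * (norm x)\<^sup>2 \<le> norm (Y x) * norm x"
      using q[of x] Re_cinner_le_norm[of "Y x" x] by (simp add: quad_def)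
    then show ?thesis using False by (simp add: power2_eq_square)
  qed simp
  have inj: "x = y" if "Y x = Y y" for x y
    using low[of "x - y"] that c by (simp add: blinfun.diff_right mult_le_0_iff)
  \<comment> \<open>adding \<open>c\<close> keeps \<open>d\<close> positive when the space is zero, where \<open>norm Y = 0\<close>\<close>
  define d where "d = norm Y + c"
  have d: "0 < d" using c by (simp add: d_def add_nonneg_pos)
  define T where "T = id_blinfun - (1 / d) *\<^sub>R Y"
  have "norm T \<le> 1 - c / d"
  proof (rule self_adjoint_norm_le)
    show "self_adjoint T" using Y by (simp add: T_def)
    show "0 \<le> 1 - c / d" using d c by (simp add: d_def)
    show "\<bar>quad T x\<bar> \<le> (1 - c / d) * (norm x)\<^sup>2" for x
    proof -
      have "quad Y x \<le> norm Y * (norm x)\<^sup>2" using abs_quad_le[of Y x] by simp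
      also have "\<dots> \<le> d * (norm x)\<^sup>2" using c by (intro mult_right_mono) (auto simp: d_def)
      finally have "quad Y x / d \<le> (norm x)\<^sup>2" using d by (simp add: field_simps)
      moreover have "c * (norm x)\<^sup>2 / d \<le> quad Y x / d" using q d by (simp add: divide_right_mono)
      moreover have "quad T x = (norm x)\<^sup>2 - quad Y x / d" by (simp add: T_def)
      moreover have "(1 - c / d) * (norm x)\<^sup>2 = (norm x)\<^sup>2 - c * (norm x)\<^sup>2 / d"
        by (simp add: algebra_simps)
      ultimately show ?thesis by (intro abs_leI) linarith+
    qed
  qed
  moreover have "0 < c / d" using c d by simp
  ultimately have T: "norm T < 1" by linarith
  have surj: "\<exists>x. Y x = y" for y
  proof -
    have "\<exists>!x. T x + (1 / d) *\<^sub>R y = x"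
      using T norm_blinfun[of T]
      by (intro banach_fix_type[of "norm T"]) (auto simp: dist_norm simp flip: blinfun.diff_right)
    then obtain x where "T x + (1 / d) *\<^sub>R y = x" by blast
    then have "(1 / d) *\<^sub>R y = (1 / d) *\<^sub>R Y x"
      by (simp add: T_def blinfun.bilinear_simps algebra_simps)
    then show ?thesis using d by auto
  qed
  define Z where "Z = (\<lambda>y. SOME x. Y x = y)"
  have YZ: "Y (Z y) = y" for y unfolding Z_def using surj by (rule someI_ex)
  have ZY: "Z (Y x) = x" for x using YZ inj by blast
  have "hs_operator hs_UNIV Z"
    unfolding hs_operator_def hs_norm_UNIV
  proof (intro conjI)
    show "\<exists>C. \<forall>x\<in>hs_carrier hs_UNIV. norm (Z x) \<le> C * norm x"
    proof (intro exI ballI)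
      fix x show "norm (Z x) \<le> 1 / c * norm x"
        using low[of "Z x"] c by (simp add: YZ field_simps)
    qed
    have "Z (scaleC e x) = scaleC e (Z x)" for e x
      by (rule inj) (use self_adjoint_clinear[OF Y] in \<open>simp add: YZ clinear_op_def\<close>)
    moreover have "Z (x + y) = Z x + Z y" for x y
      by (rule inj) (simp add: YZ blinfun.add_right)
    ultimately show
      "\<forall>x\<in>hs_carrier hs_UNIV. \<forall>y\<in>hs_carrier hs_UNIV. Z (x + y) = Z x + Z y"
      "\<forall>e. \<forall>x\<in>hs_carrier hs_UNIV. Z (hs_scale hs_UNIV e x) = hs_scale hs_UNIV e (Z x)"
      by (auto simp: hs_UNIV_def)
  qed (simp add: hs_UNIV_def)
  then show thesis using that YZ ZY by blast
qed

text \<open>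
  For \<open>t\<close> outside the interval, one of \<open>X - t\<close> and \<open>t - X\<close> has a form with a positive lower bound,
  so it is invertible.
\<close>

lemma real_spectrum_between:
  assumes X: "op_between a b X" and t: "t \<in> real_spectrum X"
  shows "t \<in> {a..b}"
proof (rule ccontr)
  assume nt: "t \<notin> {a..b}"
  have sa: "self_adjoint X" and q: "a * (norm x)\<^sup>2 \<le> quad X x" "quad X x \<le> b * (norm x)\<^sup>2" for x
    using X unfolding op_between_def by auto
  obtain s c where s: "s = 1 \<or> s = -1" and c: "0 < c"
    and low: "\<And>x. c * (norm x)\<^sup>2 \<le> quad (s *\<^sub>R (X - t *\<^sub>R id_blinfun)) x"
  proof (cases "t < a")
    case True
    have "(a - t) * (norm x)\<^sup>2 \<le> quad (1 *\<^sub>R (X - t *\<^sub>R id_blinfun)) x" for x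
      using q(1)[of x] by (simp add: algebra_simps)
    then show thesis using that[of 1 "a - t"] True by simp
  next
    case False
    have "(t - b) * (norm x)\<^sup>2 \<le> quad ((-1) *\<^sub>R (X - t *\<^sub>R id_blinfun)) x" for x
      using q(2)[of x] by (simp only: quad_simps) (simp add: algebra_simps)
    then show thesis using that[of "-1" "t - b"] False nt by simp
  qed
  define Y where "Y = s *\<^sub>R (X - t *\<^sub>R id_blinfun)"
  have "self_adjoint Y" using sa by (simp add: Y_def)
  then obtain Z where Z: "hs_operator hs_UNIV Z" "\<And>x. Z (Y x) = x" "\<And>x. Y (Z x) = x"
    using invertible_if_quad_bounded_below[of Y c] low c unfolding Y_def by blast
  have "hs_operator hs_UNIV (\<lambda>x. Z (s *\<^sub>R x))"
  proof -
    have hom: "Z (scaleC e x) = scaleC e (Z x)" and "Z (x + y) = Z x + Z y" for e x y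
      using Z(1) unfolding hs_operator_def by (auto simp: hs_UNIV_def)
    moreover obtain C where C: "\<And>x. norm (Z x) \<le> C * norm x"
      using Z(1) unfolding hs_operator_def hs_norm_UNIV by (auto simp: hs_UNIV_def)
    moreover have "norm (Z (s *\<^sub>R x)) \<le> C * norm x" for x
      using C[of "s *\<^sub>R x"] s by auto
    moreover have "Z (s *\<^sub>R scaleC e x) = scaleC e (Z (s *\<^sub>R x))" for e x
      by (simp flip: scaleC_of_real hom add: scaleC_scaleC mult.commute)
    ultimately show ?thesis unfolding hs_operator_def hs_norm_UNIV
      by (auto simp: hs_UNIV_def scaleR_add_right)
  qed
  moreover have "Z (s *\<^sub>R (X x - scaleC (complex_of_real t) x)) = x" for x
    using Z(2)[of x] by (simp add: Y_def blinfun.bilinear_simps scaleC_of_real)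
  moreover have "X (Z (s *\<^sub>R x)) - scaleC (complex_of_real t) (Z (s *\<^sub>R x)) = x" for x
  proof -
    have "s *\<^sub>R (X (Z (s *\<^sub>R x)) - scaleC (complex_of_real t) (Z (s *\<^sub>R x))) = s *\<^sub>R x"
      using Z(3)[of "s *\<^sub>R x"] by (simp add: Y_def blinfun.bilinear_simps scaleC_of_real)
    then show ?thesis using s by auto
  qed
  ultimately have "complex_of_real t \<notin> hs_spectrum hs_UNIV (blinfun_apply X)"
    unfolding hs_spectrum_def by (auto simp: hs_UNIV_def intro!: exI[of _ "\<lambda>x. Z (s *\<^sub>R x)"])
  then show False using t by simp
qed

lemma norm_poly_op_le_between:
  assumes "op_between a b X" and "\<And>t. t \<in> {a..b} \<Longrightarrow> \<bar>poly P t\<bar> \<le> e" and "0 \<le> e"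
  shows "norm (poly_op X P) \<le> e"
  using assms real_spectrum_between[OF assms(1)]
  by (intro norm_poly_op_le) (auto simp: op_between_def)


section \<open>The continuous functional calculus\<close>

lemma hs_onorm_UNIV: "hs_onorm hs_UNIV (blinfun_apply T) = norm (T::'h::complex_hilbert \<Rightarrow>\<^sub>L 'h)"
proof -
  let ?S = "{x::'h. norm x \<le> 1}"
  have S: "hs_onorm hs_UNIV (blinfun_apply T) = (SUP x\<in>?S. norm (T x))"
    by (simp add: hs_onorm_def hs_norm_UNIV) (simp add: hs_UNIV_def)
  have le: "norm (T x) \<le> norm T" if "norm x \<le> 1" for x
    using norm_blinfun[of T x] mult_left_le[OF that norm_ge_zero[of T]] by simp
  have bdd: "bdd_above ((\<lambda>x. norm (T x)) ` ?S)" using le by (intro bdd_aboveI2) auto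
  have up: "norm (T x) \<le> (SUP x\<in>?S. norm (T x))" if "norm x \<le> 1" for x
    using that by (intro cSUP_upper[OF _ bdd]) auto
  have "norm T \<le> (SUP x\<in>?S. norm (T x))"
  proof (rule norm_blinfun_bound)
    show "0 \<le> (SUP x\<in>?S. norm (T x))" using up[of 0] by simp
    fix x
    show "norm (T x) \<le> (SUP x\<in>?S. norm (T x)) * norm x"
    proof (cases "x = 0")
      case False
      have "norm (T x) / norm x \<le> (SUP x\<in>?S. norm (T x))"
        using up[of "(1 / norm x) *\<^sub>R x"] False by (simp add: blinfun.scaleR_right)
      then show ?thesis using False by (simp add: field_simps)
    qed simp
  qed
  moreover have "(SUP x\<in>?S. norm (T x)) \<le> norm T"
    using le by (intro cSUP_least) (auto intro: exI[of _ 0])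
  ultimately show ?thesis using S by simp
qed

lemma hs_has_cfc_UNIV_iff:
  assumes "self_adjoint X"
  shows "hs_has_cfc hs_UNIV f (blinfun_apply X) (blinfun_apply Y) \<longleftrightarrow> clinear_op Y \<and>
     (\<exists>P. uniform_limit (real_spectrum X) (\<lambda>n. poly (P n)) f sequentially \<and>
       (\<lambda>n. poly_op X (P n)) \<longlonglongrightarrow> Y)"
proof -
  have "(\<lambda>x. hs_poly hs_UNIV P (blinfun_apply X) x - Y x) = blinfun_apply (poly_op X P - Y)" for P
    by (rule ext) (simp add: hs_poly_UNIV[OF self_adjoint_clinear[OF assms]] blinfun.diff_left)
  moreover have "(\<lambda>n. norm (poly_op X (P n) - Y)) \<longlonglongrightarrow> 0 \<longleftrightarrow> (\<lambda>n. poly_op X (P n)) \<longlonglongrightarrow> Y" for P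
    unfolding tendsto_norm_zero_iff LIM_zero_iff ..
  ultimately show ?thesis
    unfolding hs_has_cfc_def hs_operator_UNIV_iff by (simp only: hs_onorm_UNIV)
qed

lemma uniform_limit_poly_exists:
  assumes "continuous_on {a..b} f"
  obtains P :: "nat \<Rightarrow> real poly" where "uniform_limit {a..b} (\<lambda>n. poly (P n)) f sequentially"
proof -
  have "\<exists>P. \<forall>t\<in>{a..b}. \<bar>f t - poly P t\<bar> < 1 / real (Suc n)" for n
  proof -
    obtain g where g: "real_polynomial_function g" "\<And>t. t \<in> {a..b} \<Longrightarrow> \<bar>f t - g t\<bar> < 1 / real (Suc n)"
      using Stone_Weierstrass_real_polynomial_function[OF compact_Icc assms, of "1 / real (Suc n)"]
      by auto
    then obtain c k where "g = (\<lambda>t. \<Sum>i\<le>k. c i * t ^ i)"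
      using real_polynomial_function_iff_sum by auto
    then have "g t = poly (\<Sum>i\<le>k. monom (c i) i) t" for t
      by (simp add: poly_sum poly_monom)
    then show ?thesis using g(2) by metis
  qed
  then obtain P where P: "\<And>n t. t \<in> {a..b} \<Longrightarrow> \<bar>f t - poly (P n) t\<bar> < 1 / real (Suc n)" by metis
  have "uniform_limit {a..b} (\<lambda>n. poly (P n)) f sequentially"
  proof (rule uniform_limitI)
    fix e :: real assume "0 < e"
    then have "\<forall>\<^sub>F n in sequentially. 1 / real (Suc n) < e"
      using LIMSEQ_inverse_real_of_nat by (intro order_tendstoD) (auto simp: inverse_eq_divide)
    then show "\<forall>\<^sub>F n in sequentially. \<forall>t\<in>{a..b}. dist (poly (P n) t) (f t) < e"
    proof eventually_elim
      case (elim n)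
      then show ?case using P[of _ n] by (metis dist_commute dist_real_def less_trans)
    qed
  qed
  then show thesis by (rule that)
qed

lemma uniform_limit_bound:
  fixes f :: "'a \<Rightarrow> real"
  assumes "uniform_limit S g f sequentially" and "0 < e"
  shows "\<exists>N. \<forall>n\<ge>N. \<forall>t\<in>S. \<bar>g n t - f t\<bar> < e"
  using uniform_limitD[OF assms] unfolding eventually_sequentially dist_real_def .

lemma tendsto_cinner_apply:
  fixes Y :: "'h::complex_hilbert \<Rightarrow>\<^sub>L 'h"
  assumes "Z \<longlonglongrightarrow> Y"
  shows "(\<lambda>n. cinner (Z n x) y) \<longlonglongrightarrow> cinner (Y x) y"
proof -
  have lim: "(\<lambda>n. norm (Z n - Y) * norm x * norm y) \<longlonglongrightarrow> 0"
    using LIM_zero[OF assms] by (intro tendsto_mult_left_zero) (rule tendsto_norm_zero)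
  have "cmod (cinner (Z n x) y - cinner (Y x) y) \<le> norm (Z n - Y) * norm x * norm y" for n
    using norm_cinner_le[of "(Z n - Y) x" y] mult_right_mono[OF norm_blinfun[of "Z n - Y" x], of "norm y"]
    by (simp add: blinfun.diff_left cinner_simps)
  then have "(\<lambda>n. cinner (Z n x) y - cinner (Y x) y) \<longlonglongrightarrow> 0"
    by (intro Lim_null_comparison[OF eventuallyI lim])
  then show ?thesis by (rule LIM_zero_cancel)
qed

lemma self_adjoint_limit:
  fixes Y :: "'h::complex_hilbert \<Rightarrow>\<^sub>L 'h"
  assumes Z: "Z \<longlonglongrightarrow> Y" and sa: "\<And>n. self_adjoint (Z n)"
  shows "self_adjoint Y"
  unfolding self_adjoint_def
proof safe
  fix x y
  have 1: "(\<lambda>n. cinner (Z n x) y) \<longlonglongrightarrow> cinner (Y x) y" by (rule tendsto_cinner_apply[OF Z])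
  have "(\<lambda>n. cnj (cinner (Z n y) x)) \<longlonglongrightarrow> cnj (cinner (Y y) x)"
    by (intro tendsto_cnj tendsto_cinner_apply[OF Z])
  moreover have "cnj (cinner (Z n y) x) = cinner (Z n x) y" for n
    using sa[of n] cinner_commute[of x "Z n y"] by (simp add: self_adjoint_def)
  moreover have "cnj (cinner (Y y) x) = cinner x (Y y)" using cinner_commute[of x "Y y"] by simp
  ultimately show "cinner (Y x) y = cinner x (Y y)" using 1 LIMSEQ_unique by fastforce
qed

text \<open>Uniqueness rests on the spectrum alone; existence uses approximation on the whole interval.\<close>

lemma poly_op_limit_unique:
  assumes X: "self_adjoint X"
    and P: "uniform_limit (real_spectrum X) (\<lambda>n. poly (P n)) f sequentially"
      "(\<lambda>n. poly_op X (P n)) \<longlonglongrightarrow> Y"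
    and Q: "uniform_limit (real_spectrum X) (\<lambda>n. poly (Q n)) f sequentially"
      "(\<lambda>n. poly_op X (Q n)) \<longlonglongrightarrow> Z"
  shows "Y = Z"
proof -
  have "uniform_limit (real_spectrum X) (\<lambda>n t. poly (P n - Q n) t) (\<lambda>t. f t - f t) sequentially"
    using uniform_limit_minus[OF P(1) Q(1)] by simp
  then have u: "uniform_limit (real_spectrum X) (\<lambda>n t. poly (P n - Q n) t) (\<lambda>t. 0) sequentially"
    by simp
  have "(\<lambda>n. poly_op X (P n - Q n)) \<longlonglongrightarrow> 0"
  proof (rule tendstoI)
    fix e :: real assume e: "0 < e"
    have "\<forall>\<^sub>F n in sequentially. \<forall>t\<in>real_spectrum X. dist (poly (P n - Q n) t) 0 < e / 2"
      using uniform_limitD[OF u, of "e / 2"] e by simp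
    then show "\<forall>\<^sub>F n in sequentially. dist (poly_op X (P n - Q n)) 0 < e"
    proof eventually_elim
      case (elim n)
      have "norm (poly_op X (P n - Q n)) \<le> e / 2"
        using elim e by (intro norm_poly_op_le[OF X]) (auto simp: less_imp_le)
      then show ?case using e by simp
    qed
  qed
  moreover have "(\<lambda>n. poly_op X (P n - Q n)) \<longlonglongrightarrow> Y - Z"
    using tendsto_diff[OF P(2) Q(2)] by (simp add: poly_op_diff)
  ultimately show ?thesis using LIMSEQ_unique by fastforce
qed

lemma cfc_eqI:
  assumes X: "op_between a b X"
    and P: "uniform_limit {a..b} (\<lambda>n. poly (P n)) f sequentially"
      "(\<lambda>n. poly_op X (P n)) \<longlonglongrightarrow> Y"
  shows "cfc f X = Y"
proof -
  have sa: "self_adjoint X" using X by (simp add: op_between_def)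
  have u: "uniform_limit (real_spectrum X) (\<lambda>n. poly (P n)) f sequentially"
    by (rule uniform_limit_on_subset[OF P(1)]) (use real_spectrum_between[OF X] in blast)
  have "self_adjoint Y" using self_adjoint_limit[OF P(2)] self_adjoint_poly_op[OF sa] by blast
  then have cl: "clinear_op Y" by (rule self_adjoint_clinear)
  show ?thesis
    unfolding cfc_def hs_has_cfc_UNIV_iff[OF sa]
  proof (rule the_equality)
    fix Z
    assume "clinear_op Z \<and> (\<exists>P. uniform_limit (real_spectrum X) (\<lambda>n. poly (P n)) f sequentially \<and>
      (\<lambda>n. poly_op X (P n)) \<longlonglongrightarrow> Z)"
    then obtain Q where "uniform_limit (real_spectrum X) (\<lambda>n. poly (Q n)) f sequentially"
      "(\<lambda>n. poly_op X (Q n)) \<longlonglongrightarrow> Z" by blast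
    then show "Z = Y" by (rule poly_op_limit_unique[OF sa _ _ u P(2)])
  qed (intro conjI exI[of _ P] cl u P(2))
qed

text \<open>
  Every approximating sequence of polynomials computes \<open>f(X)\<close>. The algebraic rules for \<open>cfc\<close> are
  limits of those for polynomials.
\<close>

lemma cfc_tendsto:
  fixes X :: "'h::complex_hilbert \<Rightarrow>\<^sub>L 'h"
  assumes X: "op_between a b X"
    and P: "uniform_limit {a..b} (\<lambda>n. poly (P n)) f sequentially"
  shows "(\<lambda>n. poly_op X (P n)) \<longlonglongrightarrow> cfc f X"
proof -
  have "Cauchy (\<lambda>n. poly_op X (P n))"
  proof (rule metric_CauchyI)
    fix e :: real assume e: "0 < e"
    then have e4: "0 < e / 4" by simp
    obtain N where N: "\<forall>n\<ge>N. \<forall>t\<in>{a..b}. \<bar>poly (P n) t - f t\<bar> < e / 4"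
      using uniform_limit_bound[OF P e4] by blast
    have "dist (poly_op X (P n)) (poly_op X (P k)) < e" if "n \<ge> N" "k \<ge> N" for n k
    proof -
      have "norm (poly_op X (P n - P k)) \<le> e / 2"
      proof (rule norm_poly_op_le_between[OF X])
        show "\<bar>poly (P n - P k) t\<bar> \<le> e / 2" if "t \<in> {a..b}" for t
        proof -
          have "\<bar>poly (P n) t - f t\<bar> < e / 4" "\<bar>poly (P k) t - f t\<bar> < e / 4"
            using N that \<open>n \<ge> N\<close> \<open>k \<ge> N\<close> by blast+
          then show ?thesis unfolding poly_diff by linarith
        qed
      qed (use e in simp)
      then show ?thesis using e by (simp add: dist_norm poly_op_diff)
    qed
    then show "\<exists>N. \<forall>n\<ge>N. \<forall>k\<ge>N. dist (poly_op X (P n)) (poly_op X (P k)) < e" by blast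
  qed
  then obtain Y where "(\<lambda>n. poly_op X (P n)) \<longlonglongrightarrow> Y"
    by (auto simp: Cauchy_convergent_iff convergent_def)
  then show ?thesis using cfc_eqI[OF X P] by simp
qed

lemma cfc_cong:
  assumes X: "op_between a b X" and f: "continuous_on {a..b} f" and "\<And>t. t \<in> {a..b} \<Longrightarrow> f t = g t"
  shows "cfc f X = cfc g X"
proof -
  obtain P where P: "uniform_limit {a..b} (\<lambda>n. poly (P n)) f sequentially"
    using uniform_limit_poly_exists[OF f] .
  have "(\<forall>t\<in>{a..b}. dist (poly (P n) t) (f t) < e) \<longleftrightarrow> (\<forall>t\<in>{a..b}. dist (poly (P n) t) (g t) < e)"
    for n e using assms(3) by (intro ball_cong) auto
  then have Q: "uniform_limit {a..b} (\<lambda>n. poly (P n)) g sequentially"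
    using P unfolding uniform_limit_iff by (simp only:)
  show ?thesis by (rule sym, rule cfc_eqI[OF X Q], rule cfc_tendsto[OF X P])
qed

lemma cfc_poly:
  assumes "op_between a b X" shows "cfc (poly P) X = poly_op X P"
  using assms by (rule cfc_eqI[of _ _ _ "\<lambda>_. P"]) (auto intro: uniform_limit_const)

lemma cfc_const:
  assumes "op_between a b X" shows "cfc (\<lambda>_. c) X = c *\<^sub>R id_blinfun"
proof -
  have "poly [:c:] = (\<lambda>_. c)" by auto
  then show ?thesis using cfc_poly[OF assms, of "[:c:]"] by (simp add: blinfun_compose_simps)
qed

lemma cfc_ident:
  assumes "op_between a b X" shows "cfc (\<lambda>t. t) X = X"
proof -
  have "poly [:0, 1:] = (\<lambda>t::real. t)" by (simp add: fun_eq_iff)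
  then show ?thesis using cfc_poly[OF assms, of "[:0, 1:]"] by (simp add: blinfun_compose_simps)
qed

lemma cfc_self_adjoint:
  assumes X: "op_between a b X" and f: "continuous_on {a..b} f"
  shows "self_adjoint (cfc f X)"
proof -
  obtain P where P: "uniform_limit {a..b} (\<lambda>n. poly (P n)) f sequentially"
    using uniform_limit_poly_exists[OF f] .
  show ?thesis
    using self_adjoint_limit[OF cfc_tendsto[OF X P]] X
    by (auto simp: op_between_def intro: self_adjoint_poly_op)
qed

lemma cfc_linear:
  assumes X: "op_between a b X" and f: "continuous_on {a..b} f" and g: "continuous_on {a..b} g"
  shows "cfc (\<lambda>t. r * f t + s * g t) X = r *\<^sub>R cfc f X + s *\<^sub>R cfc g X"
proof -
  obtain P Q where P: "uniform_limit {a..b} (\<lambda>n. poly (P n)) f sequentially"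
    and Q: "uniform_limit {a..b} (\<lambda>n. poly (Q n)) g sequentially"
    using uniform_limit_poly_exists[OF f] uniform_limit_poly_exists[OF g] by metis
  show ?thesis
  proof (rule cfc_eqI[OF X])
    show "uniform_limit {a..b} (\<lambda>n. poly (smult r (P n) + smult s (Q n)))
        (\<lambda>t. r * f t + s * g t) sequentially"
    proof -
      have "(\<lambda>n. poly (smult r (P n) + smult s (Q n)))
          = (\<lambda>n t. r * poly (P n) t + s * poly (Q n) t)" by (simp add: fun_eq_iff)
      then show ?thesis
        using uniform_limit_add[OF bounded_linear_uniform_limit_intros(13)[OF P, of r]
          bounded_linear_uniform_limit_intros(13)[OF Q, of s]] by simp
    qed
    show "(\<lambda>n. poly_op X (smult r (P n) + smult s (Q n))) \<longlonglongrightarrow> r *\<^sub>R cfc f X + s *\<^sub>R cfc g X"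
      unfolding poly_op_add poly_op_smult
      by (intro tendsto_intros cfc_tendsto[OF X] P Q)
  qed
qed

lemma cfc_mult:
  assumes X: "op_between a b X" and f: "continuous_on {a..b} f" and g: "continuous_on {a..b} g"
  shows "cfc (\<lambda>t. f t * g t) X = cfc f X o\<^sub>L cfc g X"
proof -
  obtain P Q where P: "uniform_limit {a..b} (\<lambda>n. poly (P n)) f sequentially"
    and Q: "uniform_limit {a..b} (\<lambda>n. poly (Q n)) g sequentially"
    using uniform_limit_poly_exists[OF f] uniform_limit_poly_exists[OF g] by metis
  have bd: "bounded (f ` {a..b})" "bounded (g ` {a..b})"
    using f g by (auto intro!: compact_imp_bounded compact_continuous_image)
  show ?thesis
  proof (rule cfc_eqI[OF X])
    show "uniform_limit {a..b} (\<lambda>n. poly (P n * Q n)) (\<lambda>t. f t * g t) sequentially"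
    proof -
      have "(\<lambda>n. poly (P n * Q n)) = (\<lambda>n t. poly (P n) t * poly (Q n) t)" by (simp add: fun_eq_iff)
      then show ?thesis using uniform_lim_mult[OF P Q bd] by simp
    qed
    show "(\<lambda>n. poly_op X (P n * Q n)) \<longlonglongrightarrow> (cfc f X o\<^sub>L cfc g X)"
      unfolding poly_op_mult
      by (intro bounded_bilinear.tendsto[OF bounded_bilinear_blinfun_compose] cfc_tendsto[OF X] P Q)
  qed
qed

text \<open>A nonnegative function is a square, and squares of self-adjoint operators are positive.\<close>

lemma cfc_nonneg:
  assumes X: "op_between a b X" and f: "continuous_on {a..b} f" and "\<And>t. t \<in> {a..b} \<Longrightarrow> 0 \<le> f t"
  shows "0 \<le> quad (cfc f X) x"
proof -
  have s: "continuous_on {a..b} (\<lambda>t. sqrt (f t))" using f by (intro continuous_intros)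
  have "cfc f X = cfc (\<lambda>t. sqrt (f t) * sqrt (f t)) X"
    using assms by (intro cfc_cong[OF X]) auto
  also have "\<dots> = cfc (\<lambda>t. sqrt (f t)) X o\<^sub>L cfc (\<lambda>t. sqrt (f t)) X" by (rule cfc_mult[OF X s s])
  finally show ?thesis by (simp add: quad_square[OF cfc_self_adjoint[OF X s]])
qed

lemma cfc_mono:
  assumes X: "op_between a b X" and f: "continuous_on {a..b} f" and g: "continuous_on {a..b} g"
    and "\<And>t. t \<in> {a..b} \<Longrightarrow> f t \<le> g t"
  shows "quad (cfc f X) x \<le> quad (cfc g X) x"
proof -
  have "0 \<le> quad (cfc (\<lambda>t. 1 * g t + (-1) * f t) X) x"
    using assms by (intro cfc_nonneg[OF X]) (auto intro!: continuous_intros)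
  then show ?thesis unfolding cfc_linear[OF X g f] by simp
qed

lemma norm_cfc_le:
  assumes X: "op_between a b X" and f: "continuous_on {a..b} f" and c: "0 \<le> c"
    and fc: "\<And>t. t \<in> {a..b} \<Longrightarrow> \<bar>f t\<bar> \<le> c"
  shows "norm (cfc f X) \<le> c"
proof (rule self_adjoint_norm_le[OF cfc_self_adjoint[OF X f] _ c])
  fix x
  have "quad (cfc f X) x \<le> quad (cfc (\<lambda>_. c) X) x"
    using fc by (intro cfc_mono[OF X f]) (auto simp: abs_le_iff)
  moreover have "quad (cfc (\<lambda>_. - c) X) x \<le> quad (cfc f X) x"
  proof (rule cfc_mono[OF X _ f])
    show "- c \<le> f t" if "t \<in> {a..b}" for t using fc[OF that] by linarith
  qed auto
  ultimately show "\<bar>quad (cfc f X) x\<bar> \<le> c * (norm x)\<^sup>2"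
    unfolding cfc_const[OF X] quad_simps by (simp add: abs_le_iff)
qed

lemma poly_op_continuous: "(X \<longlongrightarrow> X0) F \<Longrightarrow> ((\<lambda>s. poly_op (X s) P) \<longlongrightarrow> poly_op X0 P) F"
  by (induction P)
    (auto intro!: tendsto_intros bounded_bilinear.tendsto[OF bounded_bilinear_blinfun_compose])

text \<open>
  Approximating \<open>f\<close> by one polynomial on the common interval makes \<open>cfc f\<close> a uniform limit of
  continuous functions.
\<close>

lemma cfc_continuous:
  assumes X: "(X \<longlongrightarrow> X0) F" and b: "\<forall>\<^sub>F s in F. op_between a b (X s)" and X0: "op_between a b X0"
    and f: "continuous_on {a..b} f"
  shows "((\<lambda>s. cfc f (X s)) \<longlongrightarrow> cfc f X0) F"
proof (rule tendstoI)
  fix e :: real assume e: "0 < e"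
  obtain P where P: "uniform_limit {a..b} (\<lambda>n. poly (P n)) f sequentially"
    using uniform_limit_poly_exists[OF f] .
  have e4: "0 < e / 4" using e by simp
  obtain n where n: "\<forall>t\<in>{a..b}. \<bar>poly (P n) t - f t\<bar> < e / 4"
    using uniform_limit_bound[OF P e4] by blast
  have near: "dist (cfc f Y) (poly_op Y (P n)) \<le> e / 4" if Y: "op_between a b Y" for Y :: "'b \<Rightarrow>\<^sub>L 'b"
  proof -
    have "norm (cfc (\<lambda>t. 1 * f t + (-1) * poly (P n) t) Y) \<le> e / 4"
    proof (rule norm_cfc_le[OF Y])
      show "continuous_on {a..b} (\<lambda>t. 1 * f t + (-1) * poly (P n) t)"
        using f by (intro continuous_intros)
      show "\<bar>1 * f t + (-1) * poly (P n) t\<bar> \<le> e / 4" if "t \<in> {a..b}" for t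
        using bspec[OF n that] by linarith
    qed (use e in simp)
    moreover have "cfc (\<lambda>t. 1 * f t + (-1) * poly (P n) t) Y
        = 1 *\<^sub>R cfc f Y + (-1) *\<^sub>R cfc (poly (P n)) Y"
      by (intro cfc_linear[OF Y f] continuous_intros)
    ultimately show ?thesis by (simp add: cfc_poly[OF Y] dist_norm)
  qed
  have "\<forall>\<^sub>F s in F. dist (poly_op (X s) (P n)) (poly_op X0 (P n)) < e / 4"
    using poly_op_continuous[OF X, of "P n"] e by (intro tendstoD) auto
  with b show "\<forall>\<^sub>F s in F. dist (cfc f (X s)) (cfc f X0) < e"
  proof (rule eventually_elim2)
    fix s assume elim: "op_between a b (X s)" "dist (poly_op (X s) (P n)) (poly_op X0 (P n)) < e / 4"
    have "dist (cfc f (X s)) (cfc f X0) \<le> dist (cfc f (X s)) (poly_op (X s) (P n))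
        + dist (poly_op (X s) (P n)) (poly_op X0 (P n)) + dist (cfc f X0) (poly_op X0 (P n))"
      using dist_triangle[of "cfc f (X s)" "cfc f X0" "poly_op (X s) (P n)"]
        dist_triangle[of "poly_op (X s) (P n)" "cfc f X0" "poly_op X0 (P n)"]
        dist_commute[of "cfc f X0" "poly_op X0 (P n)"] by linarith
    then show "dist (cfc f (X s)) (cfc f X0) < e"
      using near[OF elim(1)] near[OF X0] elim(2) e by linarith
  qed
qed



section \<open>Integrals of fields of operators\<close>

lemma op_scaleC_of_real: "op_scaleC (complex_of_real r) X = r *\<^sub>R X"
  by (rule blinfun_eqI) (simp add: op_scaleC_apply scaleC_of_real blinfun.scaleR_left)

lemma cstar_algebra_scaleR: "cstar_algebra \<A> \<Longrightarrow> X \<in> \<A> \<Longrightarrow> r *\<^sub>R X \<in> \<A>"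
  unfolding cstar_algebra_def by (metis op_scaleC_of_real)

lemma cstar_algebra_diff: "cstar_algebra \<A> \<Longrightarrow> X \<in> \<A> \<Longrightarrow> Y \<in> \<A> \<Longrightarrow> X - Y \<in> \<A>"
  using cstar_algebra_scaleR[of \<A> Y "-1"] unfolding cstar_algebra_def
  by (metis diff_conv_add_uminus scaleR_minus1_left)

lemma cstar_algebra_sum:
  "cstar_algebra \<A> \<Longrightarrow> (\<And>i. i \<in> I \<Longrightarrow> Z i \<in> \<A>) \<Longrightarrow> (\<Sum>i\<in>I. Z i) \<in> \<A>"
  by (induction I rule: infinite_finite_induct) (auto simp: cstar_algebra_def)

lemma cfc_in_algebra:
  assumes \<A>: "cstar_algebra \<A>" "id_blinfun \<in> \<A>" and X: "X \<in> \<A>" "op_between a b X"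
    and f: "continuous_on {a..b} f"
  shows "cfc f X \<in> \<A>"
proof -
  obtain P where P: "uniform_limit {a..b} (\<lambda>n. poly (P n)) f sequentially"
    using uniform_limit_poly_exists[OF f] .
  have "poly_op X Q \<in> \<A>" for Q
  proof (induction Q)
    case 0
    then show ?case using \<A> by (simp add: cstar_algebra_def)
  next
    case (pCons c Q)
    then show ?case
      using \<A> X cstar_algebra_scaleR[OF \<A>(1) \<A>(2), of c] by (simp add: cstar_algebra_def)
  qed
  moreover have "closed \<A>" using \<A> by (simp add: cstar_algebra_def)
  ultimately show ?thesis
    using cfc_tendsto[OF X(2) P] by (metis closed_sequentially)
qed

lemma dual_space_linear:
  assumes \<A>: "cstar_algebra \<A>" and \<phi>: "\<phi> \<in> dual_space \<A>"
  shows dual_space_add: "X \<in> \<A> \<Longrightarrow> Y \<in> \<A> \<Longrightarrow> \<phi> (X + Y) = \<phi> X + \<phi> Y"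
    and dual_space_scaleR: "X \<in> \<A> \<Longrightarrow> \<phi> (r *\<^sub>R X) = r *\<^sub>R \<phi> X"
    and dual_space_diff: "X \<in> \<A> \<Longrightarrow> Y \<in> \<A> \<Longrightarrow> \<phi> (X - Y) = \<phi> X - \<phi> Y"
proof -
  show add: "\<phi> (X + Y) = \<phi> X + \<phi> Y" if "X \<in> \<A>" "Y \<in> \<A>" for X Y
    using \<phi> that by (simp add: dual_space_def)
  show sc: "\<phi> (r *\<^sub>R X) = r *\<^sub>R \<phi> X" if "X \<in> \<A>" for X r
  proof -
    have "\<phi> (op_scaleC (complex_of_real r) X) = complex_of_real r * \<phi> X"
      using \<phi> that by (simp add: dual_space_def)
    then show ?thesis by (simp add: op_scaleC_of_real scaleR_conv_of_real)
  qed
  show "\<phi> (X - Y) = \<phi> X - \<phi> Y" if "X \<in> \<A>" "Y \<in> \<A>" for X Y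
    using add[OF that(1) cstar_algebra_scaleR[OF \<A> that(2), of "-1"]] sc[OF that(2), of "-1"]
    by simp
qed

lemma dual_space_sum:
  assumes \<A>: "cstar_algebra \<A>" and \<phi>: "\<phi> \<in> dual_space \<A>"
  shows "(\<And>i. i \<in> I \<Longrightarrow> Z i \<in> \<A>) \<Longrightarrow> \<phi> (\<Sum>i\<in>I. Z i) = (\<Sum>i\<in>I. \<phi> (Z i))"
proof (induction I rule: infinite_finite_induct)
  case (insert i I)
  then show ?case
    using dual_space_add[OF \<A> \<phi>, of "Z i" "sum Z I"] cstar_algebra_sum[OF \<A>, of I Z] by simp
qed (use dual_space_add[OF \<A> \<phi>, of 0 0] \<A> in \<open>auto simp: cstar_algebra_def\<close>)

lemma cinner_in_dual_space:
  "(\<lambda>X::'h::complex_hilbert \<Rightarrow>\<^sub>L 'h. cinner (X x) y) \<in> dual_space \<A>"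
  unfolding dual_space_def using norm_cinner_apply_le
  by (auto simp: blinfun.add_left cinner_simps op_scaleC_apply)

lemma radon_measure_sets:
  assumes "radon_measure \<mu>"
  shows "sets \<mu> = sets borel" and "space \<mu> = UNIV"
    and "\<And>C. compact C \<Longrightarrow> C \<in> sets \<mu>" and "\<And>V. open V \<Longrightarrow> V \<in> sets \<mu>"
proof -
  show s: "sets \<mu> = sets borel" using assms by (simp add: radon_measure_def)
  show "space \<mu> = UNIV" using sets_eq_imp_space_eq[OF s] by simp
  show "C \<in> sets \<mu>" if "compact C" for C using s that by (simp add: compact_imp_closed)
  show "V \<in> sets \<mu>" if "open V" for V using s that by simp
qed

lemma radon_borel_measurable:
  fixes h :: "'t::t2_space \<Rightarrow> 'b::topological_space"
  assumes "radon_measure \<mu>" "continuous_on UNIV h"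
  shows "h \<in> borel_measurable \<mu>"
  using borel_measurable_continuous_onI[OF assms(2)] radon_measure_sets(1)[OF assms(1)]
  by (simp cong: measurable_cong_sets)

lemma emeasure_finite_subset:
  "A \<subseteq> B \<Longrightarrow> B \<in> sets M \<Longrightarrow> emeasure M B < \<infinity> \<Longrightarrow> emeasure M A < \<infinity>"
  by (rule le_less_trans[OF emeasure_mono])

lemma radon_inner_approx:
  assumes \<mu>: "radon_measure \<mu>" and V: "open V" "emeasure \<mu> V < \<infinity>" and d: "0 < d"
  obtains C where "compact C" "C \<subseteq> V" "measure \<mu> (V - C) < d"
proof -
  have Vs: "V \<in> fmeasurable \<mu>" using radon_measure_sets(4)[OF \<mu> V(1)] V(2) by (simp add: fmeasurable_def)
  have "\<exists>C. compact C \<and> C \<subseteq> V \<and> measure \<mu> V - d < measure \<mu> C"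
  proof (cases "measure \<mu> V < d")
    case True
    then show ?thesis by (intro exI[of _ "{}"]) auto
  next
    case False
    show ?thesis
    proof (rule ccontr)
      assume n: "\<not> ?thesis"
      have "emeasure \<mu> C \<le> ennreal (measure \<mu> V - d)" if "compact C" "C \<subseteq> V" for C
      proof -
        have "emeasure \<mu> C = ennreal (measure \<mu> C)"
          using fmeasurableI2[OF Vs that(2) radon_measure_sets(3)[OF \<mu> that(1)]]
          by (rule emeasure_eq_measure2)
        then show ?thesis using n that by (auto simp: not_less intro: ennreal_leI)
      qed
      then have "(SUP C\<in>{C. compact C \<and> C \<subseteq> V}. emeasure \<mu> C) \<le> ennreal (measure \<mu> V - d)"
        by (intro SUP_least) auto
      then have "emeasure \<mu> V \<le> ennreal (measure \<mu> V - d)"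
        using \<mu> V(1) unfolding radon_measure_def by metis
      then show False using emeasure_eq_measure2[OF Vs] d False by simp
    qed
  qed
  then obtain C where C: "compact C" "C \<subseteq> V" "measure \<mu> V - d < measure \<mu> C" by blast
  have "measure \<mu> (V - C) = measure \<mu> V - measure \<mu> C"
    using Vs C radon_measure_sets(3)[OF \<mu> C(1)]
    by (intro measure_Diff) (auto simp: fmeasurable_def)
  then show thesis using that C by simp
qed

text \<open>
  The open sets \<open>{h > 1/(n+1)}\<close> have finite measure and exhaust \<open>{h \<noteq> 0}\<close>; on each of them a
  compact subset carries almost all the mass of the truncation \<open>min h n\<close>.
\<close>

lemma integral_off_compact_small:
  fixes h :: "'t::t2_space \<Rightarrow> real"
  assumes \<mu>: "radon_measure \<mu>" and h: "continuous_on UNIV h" "integrable \<mu> h" "\<And>t. 0 \<le> h t"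
    and e: "0 < e"
  obtains K where "compact K" "(\<integral>t. h t * indicator (- K) t \<partial>\<mu>) < e"
proof -
  define V where "V n = {t. 1 / real (Suc n) < h t}" for n
  have openV: "open (V n)" for n
    unfolding V_def using h(1) by (intro open_Collect_less continuous_intros) auto
  note [measurable] = radon_borel_measurable[OF \<mu> h(1)] radon_measure_sets(4)[OF \<mu> openV]
  have finV: "emeasure \<mu> (V n) < \<infinity>" for n
  proof -
    have "emeasure \<mu> {t\<in>space \<mu>. h t \<ge> 1 / real (Suc n)}
        \<le> ennreal ((1 / (1 / real (Suc n))) * (\<integral>t. h t \<partial>\<mu>))"
      using h by (intro integral_Markov_inequality) auto
    also have "\<dots> < \<infinity>" by simp
    finally have "emeasure \<mu> {t\<in>space \<mu>. h t \<ge> 1 / real (Suc n)} < \<infinity>" .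
    moreover have "V n \<subseteq> {t\<in>space \<mu>. h t \<ge> 1 / real (Suc n)}"
      unfolding V_def radon_measure_sets(2)[OF \<mu>] by auto
    moreover have "{t\<in>space \<mu>. h t \<ge> 1 / real (Suc n)} \<in> sets \<mu>" by measurable
    ultimately show ?thesis using emeasure_finite_subset by blast
  qed
  define g where "g n t = h t - min (h t) (real n) * indicator (V n) t" for n t
  have g0: "0 \<le> g n t" and gh: "g n t \<le> h t" for n t
    using h(3)[of t] by (auto simp: g_def indicator_def min_def)
  have gmeas [measurable]: "g n \<in> borel_measurable \<mu>" for n
    unfolding g_def by measurable
  have gint: "integrable \<mu> (g n)" for n
    using g0 gh by (intro Bochner_Integration.integrable_bound[OF h(2)]) (auto intro!: AE_I2 simp: h(3))
  have "(\<lambda>n. \<integral>t. g n t \<partial>\<mu>) \<longlonglongrightarrow> (\<integral>t. 0 \<partial>\<mu>)"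
  proof (rule integral_dominated_convergence[where w = h])
    show "AE t in \<mu>. (\<lambda>n. g n t) \<longlonglongrightarrow> 0"
    proof (rule AE_I2)
      fix t
      show "(\<lambda>n. g n t) \<longlonglongrightarrow> 0"
      proof (cases "h t = 0")
        case True
        then show ?thesis by (simp add: g_def)
      next
        case False
        then have pos: "0 < h t" using h(3)[of t] by simp
        have "\<forall>\<^sub>F n in sequentially. 1 / real (Suc n) < h t"
          using LIMSEQ_inverse_real_of_nat pos by (intro order_tendstoD) (auto simp: inverse_eq_divide)
        moreover have "\<forall>\<^sub>F n in sequentially. h t \<le> real n"
          using eventually_ge_at_top[of "nat \<lceil>h t\<rceil>"] by eventually_elim linarith
        ultimately have "\<forall>\<^sub>F n in sequentially. g n t = 0"
          by eventually_elim (simp add: g_def V_def)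
        then show ?thesis by (rule tendsto_eventually)
      qed
    qed
    show "AE t in \<mu>. norm (g n t) \<le> h t" for n using g0 gh by auto
  qed (auto simp: h(2))
  then have "\<forall>\<^sub>F n in sequentially. (\<integral>t. g n t \<partial>\<mu>) < e / 2"
    using e by (intro order_tendstoD) auto
  then obtain n where n: "(\<integral>t. g n t \<partial>\<mu>) < e / 2" unfolding eventually_sequentially by blast
  obtain K where K: "compact K" "K \<subseteq> V n" "measure \<mu> (V n - K) < e / (2 * (real n + 1))"
    using radon_inner_approx[OF \<mu> openV finV, of "e / (2 * (real n + 1))"] e by auto
  have Ks [measurable]: "K \<in> sets \<mu>" by (rule radon_measure_sets(3)[OF \<mu> K(1)])
  have fin: "emeasure \<mu> (V n - K) < \<infinity>"
    by (rule emeasure_finite_subset[OF _ _ finV[of n]]) auto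
  have "(\<integral>t. h t * indicator (- K) t \<partial>\<mu>) \<le> (\<integral>t. g n t + real n * indicator (V n - K) t \<partial>\<mu>)"
  proof (rule integral_mono)
    have "- K \<in> sets \<mu>" using Ks radon_measure_sets(2)[OF \<mu>] by (metis Compl_eq_Diff_UNIV sets.compl_sets)
    then show "integrable \<mu> (\<lambda>t. h t * indicator (- K) t)"
      by (rule integrable_real_mult_indicator[OF _ h(2)])
    show "integrable \<mu> (\<lambda>t. g n t + real n * indicator (V n - K) t)"
      using gint fin by (intro Bochner_Integration.integrable_add integrable_mult_right) auto
    show "h t * indicator (- K) t \<le> g n t + real n * indicator (V n - K) t" for t
      using h(3)[of t] g0[of n t] by (auto simp: g_def indicator_def min_def)
  qed
  also have "\<dots> = (\<integral>t. g n t \<partial>\<mu>) + real n * measure \<mu> (V n - K)"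
    using gint fin by (subst Bochner_Integration.integral_add) auto
  also have "\<dots> < e / 2 + e / 2"
  proof (rule add_less_le_mono[OF n])
    have "real n * measure \<mu> (V n - K) \<le> (real n + 1) * (e / (2 * (real n + 1)))"
      using K(3) by (intro mult_mono) auto
    also have "\<dots> = e / 2" by (simp add: field_simps)
    finally show "real n * measure \<mu> (V n - K) \<le> e / 2" .
  qed
  finally show thesis using that K(1) by simp
qed

lemma continuous_field_functional:
  assumes \<A>: "cstar_algebra \<A>" and \<mu>: "radon_measure \<mu>" and F: "continuous_field \<A> \<mu> F"
    and \<phi>: "\<phi> \<in> dual_space \<A>"
  shows "continuous_on UNIV (\<lambda>t. \<phi> (F t))" and "integrable \<mu> (\<lambda>t. \<phi> (F t))"
proof -
  obtain C where C: "\<And>X. X \<in> \<A> \<Longrightarrow> cmod (\<phi> X) \<le> C * norm X" using \<phi> unfolding dual_space_def by blast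
  have FA: "F t \<in> \<A>" for t using F by (simp add: continuous_field_def)
  have Fc: "(F \<longlongrightarrow> F t) (at t)" for t
    using F by (auto simp: continuous_field_def continuous_on_def)
  show cont: "continuous_on UNIV (\<lambda>t. \<phi> (F t))"
    unfolding continuous_on_def
  proof
    fix t
    have "((\<lambda>s. C * norm (F s - F t)) \<longlongrightarrow> 0) (at t)"
      using tendsto_mult_right_zero[OF tendsto_norm_zero[OF LIM_zero[OF Fc[of t]]]] .
    then have "((\<lambda>s. \<phi> (F s) - \<phi> (F t)) \<longlongrightarrow> 0) (at t)"
    proof (rule Lim_null_comparison[rotated])
      show "\<forall>\<^sub>F s in at t. cmod (\<phi> (F s) - \<phi> (F t)) \<le> C * norm (F s - F t)"
        using C[OF cstar_algebra_diff[OF \<A> FA FA]] dual_space_diff[OF \<A> \<phi> FA FA] by simp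
    qed
    then show "((\<lambda>t. \<phi> (F t)) \<longlongrightarrow> \<phi> (F t)) (at t within UNIV)" by (simp add: LIM_zero_iff)
  qed
  have "integrable \<mu> (\<lambda>t. C * norm (F t))" using F by (simp add: continuous_field_def)
  then show "integrable \<mu> (\<lambda>t. \<phi> (F t))"
  proof (rule Bochner_Integration.integrable_bound)
    show "AE t in \<mu>. norm (\<phi> (F t)) \<le> norm (C * norm (F t))"
      by (intro AE_I2) (simp only: real_norm_def order_trans[OF C[OF FA] abs_ge_self])
  qed (rule radon_borel_measurable[OF \<mu> cont])
qed

text \<open>
  A Riemann sum over a partition of a compact set that carries almost all of the integral of
  \<open>norm (F t)\<close>, into pieces on which \<open>F\<close> is almost constant, approximates the integral uniformly
  over functionals of norm at most \<open>1\<close>.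
\<close>

lemma field_integral_approx:
  fixes F :: "'t::t2_space \<Rightarrow> ('h::complex_hilbert \<Rightarrow>\<^sub>L 'h)"
  assumes \<A>: "cstar_algebra \<A>" and \<mu>: "radon_measure \<mu>" and F: "continuous_field \<A> \<mu> F"
    and e: "0 < e"
  obtains Y where "Y \<in> \<A>"
    "\<And>\<phi> C. \<phi> \<in> dual_space \<A> \<Longrightarrow> 0 \<le> C \<Longrightarrow> (\<And>X. X \<in> \<A> \<Longrightarrow> cmod (\<phi> X) \<le> C * norm X) \<Longrightarrow>
       cmod (\<phi> Y - (\<integral>t. \<phi> (F t) \<partial>\<mu>)) \<le> C * e"
proof -
  have FA: "F t \<in> \<A>" for t using F by (simp add: continuous_field_def)
  have Fc: "continuous_on UNIV F" and Fi: "integrable \<mu> (\<lambda>t. norm (F t))"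
    using F by (auto simp: continuous_field_def)
  obtain K where K: "compact K" "(\<integral>t. norm (F t) * indicator (- K) t \<partial>\<mu>) < e / 2"
    by (rule integral_off_compact_small[OF \<mu> continuous_on_norm[OF Fc] Fi norm_ge_zero, of "e / 2"])
      (use e in auto)
  have Ks [measurable]: "K \<in> sets \<mu>" by (rule radon_measure_sets(3)[OF \<mu> K(1)])
  have Kfin: "emeasure \<mu> K < \<infinity>" using \<mu> K(1) by (simp add: radon_measure_def)
  have "- K \<in> sets \<mu>"
    using Ks radon_measure_sets(2)[OF \<mu>] by (metis Compl_eq_Diff_UNIV sets.compl_sets)
  then have offK: "integrable \<mu> (\<lambda>t. norm (F t) * indicator (- K) t)"
    by (rule integrable_real_mult_indicator[OF _ Fi])
  \<comment> \<open>chosen so that \<open>d * measure \<mu> K \<le> e / 2\<close>, also for a null set \<open>K\<close>\<close>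
  define d where "d = e / (2 * (measure \<mu> K + 1))"
  have d: "0 < d" unfolding d_def using e by (intro divide_pos_pos mult_pos_pos add_nonneg_pos) auto
  define U where "U t = {s. norm (F s - F t) < d}" for t
  have openU: "open (U t)" for t
    unfolding U_def using Fc by (intro open_Collect_less continuous_intros) auto
  have "K \<subseteq> (\<Union>t\<in>K. U t)" using d by (auto simp: U_def)
  then obtain T where T: "finite T" "K \<subseteq> (\<Union>t\<in>T. U t)"
    using compactE_image[OF K(1), of K U] openU by metis
  obtain r and n :: nat where r: "T = r ` {i. i < n}"
    using finite_imp_nat_seg_image_inj_on[OF T(1)] by metis
  define D where "D i = K \<inter> disjointed (\<lambda>i. U (r i)) i" for i
  have Ds [measurable]: "D i \<in> sets \<mu>" for i
    unfolding D_def disjointed_def using radon_measure_sets(4)[OF \<mu> openU] by (intro sets.Int Ks) auto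
  have Dfin: "emeasure \<mu> (D i) < \<infinity>" for i
    by (rule emeasure_finite_subset[OF _ Ks Kfin]) (auto simp: D_def)
  have Ddisj: "i = j" if "t \<in> D i" "t \<in> D j" for i j t
    using that disjoint_family_disjointed[of "\<lambda>i. U (r i)"] unfolding D_def disjoint_family_on_def
    by (metis IntD2 IntI UNIV_I empty_iff)
  have DU: "norm (F t - F (r i)) < d" if "t \<in> D i" for t i
    using that disjointed_subset[of "\<lambda>i. U (r i)" i] unfolding D_def U_def by blast
  have Dcov: "\<exists>i<n. t \<in> D i" if "t \<in> K" for t
  proof -
    have "t \<in> (\<Union>i\<in>{0..<n}. U (r i))" using that T(2) unfolding r by fastforce
    then have "t \<in> (\<Union>i\<in>{0..<n}. disjointed (\<lambda>i. U (r i)) i)"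
      unfolding finite_UN_disjointed_eq .
    then show ?thesis using that by (auto simp: D_def)
  qed
  define Y where "Y = (\<Sum>i<n. measure \<mu> (D i) *\<^sub>R F (r i))"
  show thesis
  proof (rule that)
    show "Y \<in> \<A>" unfolding Y_def by (intro cstar_algebra_sum cstar_algebra_scaleR \<A> FA)
    fix \<phi> C assume \<phi>: "\<phi> \<in> dual_space \<A>" and C: "0 \<le> C"
      and b: "\<And>X. X \<in> \<A> \<Longrightarrow> cmod (\<phi> X) \<le> C * norm X"
    define S where "S t = (\<Sum>i<n. indicat_real (D i) t *\<^sub>R \<phi> (F (r i)))" for t
    have Si: "integrable \<mu> (\<lambda>t. indicat_real (D i) t *\<^sub>R \<phi> (F (r i)))" for i
      using Dfin[of i] by (intro integrable_scaleR_left) auto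
    have Sint: "integrable \<mu> S" unfolding S_def using Si by (intro Bochner_Integration.integrable_sum)
    have "\<phi> Y = (\<Sum>i<n. measure \<mu> (D i) *\<^sub>R \<phi> (F (r i)))"
      unfolding Y_def by (subst dual_space_sum[OF \<A> \<phi>])
        (auto intro: cstar_algebra_scaleR \<A> FA simp: dual_space_scaleR[OF \<A> \<phi> FA])
    also have "\<dots> = (\<integral>t. S t \<partial>\<mu>)"
      unfolding S_def using Si Dfin by (subst Bochner_Integration.integral_sum) auto
    finally have "\<phi> Y - (\<integral>t. \<phi> (F t) \<partial>\<mu>) = (\<integral>t. S t - \<phi> (F t) \<partial>\<mu>)"
      using Sint continuous_field_functional(2)[OF \<A> \<mu> F \<phi>] by simp
    then have "cmod (\<phi> Y - (\<integral>t. \<phi> (F t) \<partial>\<mu>)) \<le> (\<integral>t. cmod (S t - \<phi> (F t)) \<partial>\<mu>)"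
      by simp
    also have "\<dots> \<le> (\<integral>t. C * (d * indicat_real K t + norm (F t) * indicator (- K) t) \<partial>\<mu>)"
    proof (rule integral_mono)
      show "integrable \<mu> (\<lambda>t. cmod (S t - \<phi> (F t)))"
        using Sint continuous_field_functional(2)[OF \<A> \<mu> F \<phi>] by simp
      show "integrable \<mu> (\<lambda>t. C * (d * indicat_real K t + norm (F t) * indicator (- K) t))"
        using Kfin offK by (intro integrable_mult_right Bochner_Integration.integrable_add) auto
      fix t
      show "cmod (S t - \<phi> (F t)) \<le> C * (d * indicat_real K t + norm (F t) * indicator (- K) t)"
      proof (cases "t \<in> K")
        case True
        then obtain i where i: "i < n" "t \<in> D i" using Dcov by blast
        have "indicat_real (D j) t = (if j = i then 1 else 0)" for j
          using Ddisj[of t i j] i(2) by (cases "j = i") (auto simp: indicator_def)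
        then have "S t = (\<Sum>j<n. if j = i then \<phi> (F (r i)) else 0)"
          unfolding S_def by (intro sum.cong) auto
        then have "S t = \<phi> (F (r i))" using i by simp
        then have "cmod (S t - \<phi> (F t)) \<le> C * norm (F (r i) - F t)"
          using b[OF cstar_algebra_diff[OF \<A> FA FA]] dual_space_diff[OF \<A> \<phi> FA FA] by simp
        also have "\<dots> \<le> C * d" using DU[OF i(2)] C by (intro mult_left_mono) (auto simp: norm_minus_commute)
        finally show ?thesis using True by simp
      next
        case False
        then have "S t = 0" unfolding S_def by (intro sum.neutral) (auto simp: D_def)
        then show ?thesis using False b[OF FA] by simp
      qed
    qed
    also have "\<dots> = C * (d * measure \<mu> K + (\<integral>t. norm (F t) * indicator (- K) t \<partial>\<mu>))"
      using Kfin offK by simp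
    also have "\<dots> \<le> C * (e / 2 + e / 2)"
    proof (rule mult_left_mono[OF add_mono C])
      have "d * measure \<mu> K \<le> d * (measure \<mu> K + 1)" using d by (intro mult_left_mono) auto
      also have "\<dots> = e / 2"
      proof -
        have "e / (2 * w) * w = e / 2" if "w \<noteq> 0" for w :: real using that by simp
        moreover have "measure \<mu> K + 1 \<noteq> 0" using measure_nonneg[of \<mu> K] by linarith
        ultimately show ?thesis unfolding d_def by blast
      qed
      finally show "d * measure \<mu> K \<le> e / 2" .
    qed (use K in simp)
    finally show "cmod (\<phi> Y - (\<integral>t. \<phi> (F t) \<partial>\<mu>)) \<le> C * e" by simp
  qed
qed

text \<open>
  The approximations of accuracy \<open>1 / (n + 1)\<close> form a Cauchy sequence: their differences are tested
  against the functionals \<open>X \<mapsto> cinner (X x) y\<close>, which determine the norm.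
\<close>

lemma op_integral_exists:
  fixes F :: "'t::t2_space \<Rightarrow> ('h::complex_hilbert \<Rightarrow>\<^sub>L 'h)"
  assumes \<A>: "cstar_algebra \<A>" and \<mu>: "radon_measure \<mu>" and F: "continuous_field \<A> \<mu> F"
  obtains Y where "Y \<in> \<A>" "\<And>\<phi>. \<phi> \<in> dual_space \<A> \<Longrightarrow> \<phi> Y = (\<integral>t. \<phi> (F t) \<partial>\<mu>)"
proof -
  have "\<exists>Y. Y \<in> \<A> \<and> (\<forall>\<phi> C. \<phi> \<in> dual_space \<A> \<longrightarrow> 0 \<le> C \<longrightarrow> (\<forall>X\<in>\<A>. cmod (\<phi> X) \<le> C * norm X) \<longrightarrow>
     cmod (\<phi> Y - (\<integral>t. \<phi> (F t) \<partial>\<mu>)) \<le> C * (1 / real (Suc n)))" for n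
    by (rule field_integral_approx[OF \<A> \<mu> F, of "1 / real (Suc n)"]) (simp, blast)
  then obtain Z where ZA: "\<And>n. Z n \<in> \<A>"
    and Z: "\<And>n \<phi> C. \<phi> \<in> dual_space \<A> \<Longrightarrow> 0 \<le> C \<Longrightarrow> (\<And>X. X \<in> \<A> \<Longrightarrow> cmod (\<phi> X) \<le> C * norm X) \<Longrightarrow>
       cmod (\<phi> (Z n) - (\<integral>t. \<phi> (F t) \<partial>\<mu>)) \<le> C * (1 / real (Suc n))"
    by metis
  have close: "norm (Z i - Z j) \<le> 1 / real (Suc i) + 1 / real (Suc j)" for i j
  proof (rule norm_op_le_if_cinner_le)
    fix x y
    let ?\<phi> = "\<lambda>X::'h \<Rightarrow>\<^sub>L 'h. cinner (X x) y" and ?C = "norm x * norm y"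
    have "cmod (?\<phi> (Z i - Z j)) = cmod ((?\<phi> (Z i) - (\<integral>t. ?\<phi> (F t) \<partial>\<mu>)) - (?\<phi> (Z j) - (\<integral>t. ?\<phi> (F t) \<partial>\<mu>)))"
      by (simp add: blinfun.diff_left cinner_simps)
    also have "\<dots> \<le> ?C * (1 / real (Suc i)) + ?C * (1 / real (Suc j))"
      by (intro order_trans[OF norm_triangle_ineq4] add_mono Z cinner_in_dual_space
        norm_cinner_apply_le) auto
    finally show "cmod (?\<phi> (Z i - Z j)) \<le> (1 / real (Suc i) + 1 / real (Suc j)) * ?C"
      by (simp only: distrib_left mult.commute[of _ ?C])
  qed simp
  have "Cauchy Z"
  proof (rule metric_CauchyI)
    fix e :: real assume "0 < e"
    then have "\<forall>\<^sub>F n in sequentially. inverse (real (Suc n)) < e / 2"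
      using LIMSEQ_inverse_real_of_nat by (intro order_tendstoD) auto
    then obtain N where N: "\<And>n. n \<ge> N \<Longrightarrow> inverse (real (Suc n)) < e / 2"
      unfolding eventually_sequentially by blast
    have "dist (Z i) (Z j) < e" if "i \<ge> N" "j \<ge> N" for i j
      using close[of i j] N[OF that(1)] N[OF that(2)] unfolding dist_norm inverse_eq_divide by linarith
    then show "\<exists>N. \<forall>i\<ge>N. \<forall>j\<ge>N. dist (Z i) (Z j) < e" by blast
  qed
  then obtain Y where Y: "Z \<longlonglongrightarrow> Y" by (auto simp: Cauchy_convergent_iff convergent_def)
  have YA: "Y \<in> \<A>" using \<A> Y ZA unfolding cstar_algebra_def by (metis closed_sequentially)
  moreover have "\<phi> Y = (\<integral>t. \<phi> (F t) \<partial>\<mu>)" if \<phi>: "\<phi> \<in> dual_space \<A>" for \<phi>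
  proof -
    obtain C0 where C0: "\<And>X. X \<in> \<A> \<Longrightarrow> cmod (\<phi> X) \<le> C0 * norm X" using \<phi> unfolding dual_space_def by blast
    define C where "C = \<bar>C0\<bar>"
    have b: "cmod (\<phi> X) \<le> C * norm X" if "X \<in> \<A>" for X
      using C0[OF that] mult_right_mono[OF abs_ge_self[of C0] norm_ge_zero[of X]] by (simp add: C_def)
    have "(\<lambda>n. \<phi> (Z n) - \<phi> Y) \<longlonglongrightarrow> 0"
    proof (rule Lim_null_comparison[OF eventuallyI])
      show "cmod (\<phi> (Z n) - \<phi> Y) \<le> C * norm (Z n - Y)" for n
        using b[OF cstar_algebra_diff[OF \<A> ZA YA]] dual_space_diff[OF \<A> \<phi> ZA YA] by simp
      show "(\<lambda>n. C * norm (Z n - Y)) \<longlonglongrightarrow> 0"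
        using tendsto_mult_right_zero[OF tendsto_norm_zero[OF LIM_zero[OF Y]]] .
    qed
    then have 1: "(\<lambda>n. \<phi> (Z n)) \<longlonglongrightarrow> \<phi> Y" by (rule LIM_zero_cancel)
    have "(\<lambda>n. \<phi> (Z n) - (\<integral>t. \<phi> (F t) \<partial>\<mu>)) \<longlonglongrightarrow> 0"
    proof (rule Lim_null_comparison[OF eventuallyI])
      show "cmod (\<phi> (Z n) - (\<integral>t. \<phi> (F t) \<partial>\<mu>)) \<le> C * inverse (real (Suc n))" for n
        using Z[OF \<phi> _ b, of n] by (simp add: C_def inverse_eq_divide)
      show "(\<lambda>n. C * inverse (real (Suc n))) \<longlonglongrightarrow> 0"
        by (rule tendsto_mult_right_zero[OF LIMSEQ_inverse_real_of_nat])
    qed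
    then have "(\<lambda>n. \<phi> (Z n)) \<longlonglongrightarrow> (\<integral>t. \<phi> (F t) \<partial>\<mu>)" by (rule LIM_zero_cancel)
    with 1 show ?thesis by (rule LIMSEQ_unique)
  qed
  ultimately show thesis by (rule that)
qed

text \<open>
  The functionals \<open>X \<mapsto> cinner (X x) y\<close> separate operators, so the description defining the integral
  has exactly one solution.
\<close>

lemma op_integral_characterization:
  fixes F :: "'t::t2_space \<Rightarrow> ('h::complex_hilbert \<Rightarrow>\<^sub>L 'h)"
  assumes \<A>: "cstar_algebra \<A>" and \<mu>: "radon_measure \<mu>" and F: "continuous_field \<A> \<mu> F"
  shows op_integral_in_algebra: "op_integral \<A> \<mu> F \<in> \<A>"
    and cinner_op_integral:
      "cinner (op_integral \<A> \<mu> F x) y = (\<integral>t. cinner (F t x) y \<partial>\<mu>)"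
proof -
  let ?P = "\<lambda>Y. Y \<in> \<A> \<and>
     (\<forall>\<phi>\<in>dual_space \<A>. integrable \<mu> (\<lambda>t. \<phi> (F t)) \<and> \<phi> Y = (\<integral>t. \<phi> (F t) \<partial>\<mu>))"
  obtain Y where Y: "?P Y"
    using op_integral_exists[OF \<A> \<mu> F] continuous_field_functional(2)[OF \<A> \<mu> F] by metis
  have inner: "cinner (Z x) y = (\<integral>t. cinner (F t x) y \<partial>\<mu>)" if "?P Z" for Z x y
    using bspec[OF conjunct2[OF that] cinner_in_dual_space[of x y]] by simp
  have "Z = Y" if "?P Z" for Z
    using inner[OF that] inner[OF Y] by (intro op_eq_if_cinner_eq) simp
  then have "?P (op_integral \<A> \<mu> F)"
    unfolding op_integral_def using Y by (intro theI[of ?P Y])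
  then show "op_integral \<A> \<mu> F \<in> \<A>"
    "cinner (op_integral \<A> \<mu> F x) y = (\<integral>t. cinner (F t x) y \<partial>\<mu>)"
    using inner by blast+
qed

lemma quad_op_integral:
  fixes F :: "'t::t2_space \<Rightarrow> ('h::complex_hilbert \<Rightarrow>\<^sub>L 'h)"
  assumes \<A>: "cstar_algebra \<A>" and \<mu>: "radon_measure \<mu>" and F: "continuous_field \<A> \<mu> F"
  shows "integrable \<mu> (\<lambda>t. quad (F t) x)"
    and "quad (op_integral \<A> \<mu> F) x = (\<integral>t. quad (F t) x \<partial>\<mu>)"
  using continuous_field_functional(2)[OF \<A> \<mu> F cinner_in_dual_space[of x x]]
  by (simp_all add: quad_def cinner_op_integral[OF \<A> \<mu> F] integral_Re integrable_Re)

lemma self_adjoint_op_integral: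
  fixes F :: "'t::t2_space \<Rightarrow> ('h::complex_hilbert \<Rightarrow>\<^sub>L 'h)"
  assumes \<A>: "cstar_algebra \<A>" and \<mu>: "radon_measure \<mu>" and F: "continuous_field \<A> \<mu> F"
    and sa: "\<And>t. self_adjoint (F t)"
  shows "self_adjoint (op_integral \<A> \<mu> F)"
  unfolding self_adjoint_def
proof safe
  fix x y
  let ?I = "op_integral \<A> \<mu> F"
  have eq: "cinner (F t x) y = cnj (cinner (F t y) x)" for t
    using sa[of t] cinner_commute[of x "F t y"] by (simp add: self_adjoint_def)
  have "cinner (?I x) y = (\<integral>t. cnj (cinner (F t y) x) \<partial>\<mu>)"
    unfolding cinner_op_integral[OF \<A> \<mu> F] by (rule Bochner_Integration.integral_cong[OF refl eq])
  also have "\<dots> = cnj (cinner (?I y) x)"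
    unfolding cinner_op_integral[OF \<A> \<mu> F] by simp
  finally have "cinner (?I x) y = cnj (cinner (?I y) x)" .
  then show "cinner (?I x) y = cinner x (?I y)" using cinner_commute[of x "?I y"] by simp
qed



section \<open>Operator concave functions are concave\<close>

text \<open>
  On a one-dimensional space operators are multiplications by numbers, the spectrum of the
  multiplication by \<open>x\<close> is \<open>{x}\<close>, and \<open>f\<close> maps it to the multiplication by \<open>f x\<close>. Operator concavity
  there is concavity of \<open>f\<close>.
\<close>

text \<open>The complex line, spanned by the indicator function of a point \<open>e\<close>.\<close>

definition line_space :: "'u \<Rightarrow> ('u \<Rightarrow> complex) hilbert_structure" where
  "line_space e = \<lparr>hs_carrier = {v. \<forall>i. i \<noteq> e \<longrightarrow> v i = 0},
     hs_scale = (\<lambda>c v i. c * v i), hs_inner = (\<lambda>u v. u e * cnj (v e))\<rparr>"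

lemma line_space_simps [simp]:
  "hs_carrier (line_space e) = {v. \<forall>i. i \<noteq> e \<longrightarrow> v i = 0}"
  "hs_scale (line_space e) = (\<lambda>c v i. c * v i)"
  "hs_inner (line_space e) u v = u e * cnj (v e)"
  by (simp_all add: line_space_def)

lemma hs_norm_line_space [simp]: "hs_norm (line_space e) v = cmod (v e)"
  by (simp add: hs_norm_def cmod_def power2_eq_square)

lemma hilbert_space_line_space: "hilbert_space (line_space e)"
proof -
  have vs: "vector_space (\<lambda>c (v::'a \<Rightarrow> complex) i. c * v i)"
    by unfold_locales (auto simp: fun_eq_iff algebra_simps)
  have "module.subspace (\<lambda>c (v::'a \<Rightarrow> complex) i. c * v i) {v. \<forall>i. i \<noteq> e \<longrightarrow> v i = 0}"
    using vs by (simp add: module.subspace_def vector_space_def module_def)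
  moreover have "\<exists>l\<in>{v. \<forall>i. i \<noteq> e \<longrightarrow> v i = 0}. (\<lambda>n. cmod ((s n - l) e)) \<longlonglongrightarrow> 0"
    if s: "\<forall>d>0. \<exists>N. \<forall>i\<ge>N. \<forall>j\<ge>N. cmod ((s i - s j) e) < d" for s :: "nat \<Rightarrow> 'a \<Rightarrow> complex"
  proof -
    have "Cauchy (\<lambda>n. s n e)" using s by (auto simp: Cauchy_iff)
    then obtain c where c: "(\<lambda>n. s n e) \<longlonglongrightarrow> c" by (auto simp: Cauchy_convergent_iff convergent_def)
    show ?thesis
      using tendsto_norm_zero[OF LIM_zero[OF c]]
      by (intro bexI[of _ "\<lambda>i. if i = e then c else 0"]) auto
  qed
  moreover have "0 < Re (v e * cnj (v e))" if "\<forall>i. i \<noteq> e \<longrightarrow> v i = 0" "v \<noteq> 0" for v :: "'a \<Rightarrow> complex"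
  proof -
    have "v e \<noteq> 0"
    proof
      assume "v e = 0"
      then have "v = 0" using that(1) by (intro ext) (metis zero_fun_apply)
      then show False using that(2) by simp
    qed
    then show ?thesis by (simp add: complex_mult_cnj complex_eq_iff sum_power2_gt_zero_iff)
  qed
  ultimately show ?thesis
    unfolding hilbert_space_def line_space_simps hs_norm_line_space
    using vs by (auto simp: algebra_simps)
qed

lemma hs_operator_line_space: "hs_operator (line_space e) (\<lambda>v i. c * v i)"
  unfolding hs_operator_def
  by (auto simp: algebra_simps norm_mult fun_eq_iff intro!: exI[of _ "cmod c"])

lemma hs_selfadjoint_line_space: "hs_selfadjoint (line_space e) (\<lambda>v i. complex_of_real x * v i)"
  unfolding hs_selfadjoint_def by (simp add: hs_operator_line_space)

lemma hs_spectrum_line_space: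
  "hs_spectrum (line_space e) (\<lambda>v i. complex_of_real x * v i) \<subseteq> {complex_of_real x}"
proof safe
  fix z assume z: "z \<in> hs_spectrum (line_space e) (\<lambda>v i. complex_of_real x * v i)"
  show "z = complex_of_real x"
  proof (rule ccontr)
    assume "z \<noteq> complex_of_real x"
    then have nz: "complex_of_real x - z \<noteq> 0" by simp
    define w where "w = 1 / (complex_of_real x - z)"
    have w: "w * (complex_of_real x * a - z * a) = a" "complex_of_real x * (w * a) - z * (w * a) = a" for a
      using nz by (simp_all add: w_def divide_simps) (simp_all add: algebra_simps)
    have "hs_operator (line_space e) (\<lambda>v i. w * v i)" by (rule hs_operator_line_space)
    then have "z \<notin> hs_spectrum (line_space e) (\<lambda>v i. complex_of_real x * v i)"
      unfolding hs_spectrum_def by (auto intro!: exI[of _ "\<lambda>v i. w * v i"] simp: fun_eq_iff w)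
    then show False using z by simp
  qed
qed

lemma hs_has_cfc_line_space:
  "hs_has_cfc (line_space e) f (\<lambda>v i. complex_of_real x * v i) (\<lambda>v i. complex_of_real (f x) * v i)"
  unfolding hs_has_cfc_def
proof (intro conjI exI[of _ "\<lambda>_. [:f x:]"])
  show "hs_operator (line_space e) (\<lambda>v i. complex_of_real (f x) * v i)"
    by (rule hs_operator_line_space)
  show "uniform_limit {t. complex_of_real t \<in> hs_spectrum (line_space e) (\<lambda>v i. complex_of_real x * v i)}
      (\<lambda>n. poly [:f x:]) f sequentially"
    using hs_spectrum_line_space[of e x] by (intro uniform_limitI always_eventually) auto
  have "(\<lambda>v. hs_poly (line_space e) [:f x:] (\<lambda>v i. complex_of_real x * v i) v
      - (\<lambda>i. complex_of_real (f x) * v i)) = (\<lambda>v. 0)"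
    by (simp add: hs_poly_def fun_eq_iff)
  moreover have "{v. (\<forall>i. i \<noteq> e \<longrightarrow> v i = 0) \<and> cmod (v e) \<le> 1} \<noteq> {}"
    by (auto intro!: exI[of _ "\<lambda>_. 0"])
  ultimately show "(\<lambda>n. hs_onorm (line_space e) (\<lambda>v. hs_poly (line_space e) [:f x:]
      (\<lambda>v i. complex_of_real x * v i) v - (\<lambda>i. complex_of_real (f x) * v i))) \<longlonglongrightarrow> 0"
    by (simp only:) (simp add: hs_onorm_def)
qed

lemma operator_concave_imp_concave:
  assumes f: "operator_concave TYPE('u \<Rightarrow> complex) J f"
  shows "concave_on J f"
  unfolding concave_on_iff
proof (intro conjI ballI allI impI)
  show "convex J" using f by (simp add: operator_concave_def is_interval_convex)
  fix x y u v :: real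
  assume x: "x \<in> J" and y: "y \<in> J" and uv: "0 \<le> u" "0 \<le> v" "u + v = 1"
  \<comment> \<open>any point of the index type serves\<close>
  define e where "e = (undefined :: 'u)"
  let ?m = "\<lambda>c (v::'u \<Rightarrow> complex) i. complex_of_real c * v i"
  have v: "v = 1 - u" using uv by simp
  have comb: "(\<lambda>w. hs_scale (line_space e) (complex_of_real u) (?m a w)
      + hs_scale (line_space e) (complex_of_real (1 - u)) (?m b w)) = ?m (u * a + v * b)" for a b
    by (simp add: fun_eq_iff v algebra_simps)
  have "\<forall>X Y FX FY FZ. \<forall>l\<in>{0..1}.
          hs_selfadjoint (line_space e) X \<and> hs_selfadjoint (line_space e) Y \<and>
          hs_spectrum (line_space e) X \<subseteq> complex_of_real ` J \<and>
          hs_spectrum (line_space e) Y \<subseteq> complex_of_real ` J \<and>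
          hs_has_cfc (line_space e) f X FX \<and> hs_has_cfc (line_space e) f Y FY \<and>
          hs_has_cfc (line_space e) f
            (\<lambda>x. hs_scale (line_space e) (complex_of_real l) (X x)
               + hs_scale (line_space e) (complex_of_real (1 - l)) (Y x)) FZ
          \<longrightarrow> hs_le (line_space e)
            (\<lambda>x. hs_scale (line_space e) (complex_of_real l) (FX x)
               + hs_scale (line_space e) (complex_of_real (1 - l)) (FY x)) FZ"
    using f hilbert_space_line_space[of e] unfolding operator_concave_def by blast
  from this[THEN spec[of _ "?m x"], THEN spec[of _ "?m y"], THEN spec[of _ "?m (f x)"],
      THEN spec[of _ "?m (f y)"], THEN spec[of _ "?m (f (u * x + v * y))"], THEN bspec[of _ _ u]]
  have "hs_le (line_space e) (?m (u * f x + v * f y)) (?m (f (u * x + v * y)))"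
    unfolding comb
    using uv x y hs_spectrum_line_space[of e x] hs_spectrum_line_space[of e y]
      hs_selfadjoint_line_space[of e] hs_has_cfc_line_space[of e f]
    by (auto simp del: of_real_add of_real_mult of_real_diff)
  then have "Re (hs_inner (line_space e) (?m (u * f x + v * f y) (\<lambda>i. if i = e then 1 else 0))
        (\<lambda>i. if i = e then 1 else 0))
      \<le> Re (hs_inner (line_space e) (?m (f (u * x + v * y)) (\<lambda>i. if i = e then 1 else 0))
        (\<lambda>i. if i = e then 1 else 0))"
    unfolding hs_le_def by (elim conjE bspec) simp
  then show "u * f x + v * f y \<le> f (u *\<^sub>R x + v *\<^sub>R y)" by simp
qed

lemma concave_on_above_chord:
  fixes f :: "real \<Rightarrow> real"
  assumes f: "concave_on J f" and J: "m \<in> J" "M \<in> J" and t: "t \<in> {m..M}" and "m < M"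
  shows "(f M - f m) / (M - m) * t + (M * f m - m * f M) / (M - m) \<le> f t"
proof -
  define u where "u = (M - t) / (M - m)"
  define v where "v = (t - m) / (M - m)"
  have uv: "0 \<le> u" "0 \<le> v" "u + v = 1"
    using t \<open>m < M\<close> by (auto simp: u_def v_def simp flip: add_divide_distrib)
  have eqs: "u * m + v * M = t" "u * f m + v * f M = (f M - f m) / (M - m) * t + (M * f m - m * f M) / (M - m)"
  proof -
    have "(M - m) * (u * m + v * M) = (M - m) * t"
      using \<open>m < M\<close> unfolding u_def v_def by (simp add: distrib_left) (simp add: algebra_simps)
    then show "u * m + v * M = t" using \<open>m < M\<close> by simp
    have "u * f m + v * f M = ((M - t) * f m + (t - m) * f M) / (M - m)"
      by (simp add: u_def v_def add_divide_distrib)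
    also have "(M - t) * f m + (t - m) * f M = (f M - f m) * t + (M * f m - m * f M)"
      by (simp add: algebra_simps)
    finally show "u * f m + v * f M = (f M - f m) / (M - m) * t + (M * f m - m * f M) / (M - m)"
      by (simp add: add_divide_distrib)
  qed
  have "u * f m + v * f M \<le> f (u *\<^sub>R m + v *\<^sub>R M)"
    using f J uv unfolding concave_on_iff by blast
  then show ?thesis using eqs by simp
qed



section \<open>Perspectives of functions\<close>

lemma strictly_positive_between:
  assumes "strictly_positive A"
  obtains a b where "0 < a" "op_between a b A"
proof -
  obtain c where c: "0 < c" "self_adjoint A" "\<And>x. c * (norm x)\<^sup>2 \<le> quad A x"
    using strictly_positive_bounded_below[OF assms] by blast
  have "op_between c (norm A) A"
    unfolding op_between_def using c abs_quad_le[of A] by (auto simp: abs_le_iff)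
  then show thesis using that c(1) by blast
qed

lemma continuous_on_powr_const:
  "0 < a \<Longrightarrow> continuous_on {a..b} (\<lambda>t::real. t powr q)"
  by (intro continuous_on_powr continuous_intros) auto

lemma op_powr_self_adjoint: "0 < a \<Longrightarrow> op_between a b A \<Longrightarrow> self_adjoint (op_powr A q)"
  unfolding op_powr_def by (intro cfc_self_adjoint continuous_on_powr_const)

lemma op_powr_compose:
  assumes a: "0 < a" and A: "op_between a b A"
  shows "op_powr A p o\<^sub>L op_powr A q = op_powr A (p + q)"
proof -
  have "op_powr A p o\<^sub>L op_powr A q = cfc (\<lambda>t. t powr p * t powr q) A"
    unfolding op_powr_def by (rule cfc_mult[OF A, symmetric]) (rule continuous_on_powr_const[OF a])+
  also have "\<dots> = op_powr A (p + q)"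
    unfolding op_powr_def
    by (rule cfc_cong[OF A]) (auto intro!: continuous_on_mult continuous_on_powr_const a simp: powr_add)
  finally show ?thesis .
qed

lemma op_powr_0:
  assumes a: "0 < a" and A: "op_between a b A" shows "op_powr A 0 = id_blinfun"
proof -
  have "op_powr A 0 = cfc (\<lambda>t. 1) A"
    unfolding op_powr_def by (rule cfc_cong[OF A continuous_on_powr_const[OF a]]) (use a in auto)
  then show ?thesis by (simp add: cfc_const[OF A])
qed

lemma op_powr_1:
  assumes a: "0 < a" and A: "op_between a b A" shows "op_powr A 1 = A"
proof -
  have "op_powr A 1 = cfc (\<lambda>t. t) A"
    unfolding op_powr_def by (rule cfc_cong[OF A continuous_on_powr_const[OF a]]) (use a in auto)
  then show ?thesis by (simp add: cfc_ident[OF A])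
qed

lemma norm_op_powr_half:
  assumes a: "0 < a" and A: "op_between a b A"
  shows "(norm (op_powr A (1/2) x))\<^sup>2 = quad A x"
  using quad_square[OF op_powr_self_adjoint[OF a A], of "1/2" x]
  by (simp add: op_powr_compose[OF a A] op_powr_1[OF a A])

lemma op_transfer_between:
  assumes A: "strictly_positive A" and B: "m *\<^sub>R A \<preceq>\<^sub>L B" "B \<preceq>\<^sub>L M *\<^sub>R A"
  shows "op_between m M (op_transfer A B)"
proof -
  obtain a b where a: "0 < a" and Ab: "op_between a b A" using strictly_positive_between[OF A] .
  let ?R = "op_powr A (-1/2)"
  have R: "self_adjoint ?R" by (rule op_powr_self_adjoint[OF a Ab])
  have "?R o\<^sub>L op_powr A 1 o\<^sub>L ?R = id_blinfun"
    by (simp add: op_powr_compose[OF a Ab] op_powr_0[OF a Ab])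
  then have "quad (?R o\<^sub>L A o\<^sub>L ?R) x = (norm x)\<^sup>2" for x by (simp add: op_powr_1[OF a Ab])
  then have q: "quad A (?R x) = (norm x)\<^sup>2" for x unfolding quad_sandwich[OF R] .
  have "self_adjoint B" "m * quad A x \<le> quad B x" "quad B x \<le> M * quad A x" for x
    using B by (auto simp: op_le_iff)
  then show ?thesis
    unfolding op_between_def op_transfer_def using R q quad_sandwich[OF R] by (metis self_adjoint_sandwich)
qed

lemma op_transfer_sandwich:
  assumes A: "strictly_positive A"
  shows "op_powr A (1/2) o\<^sub>L op_transfer A B o\<^sub>L op_powr A (1/2) = B"
proof -
  obtain a b where a: "0 < a" and Ab: "op_between a b A" using strictly_positive_between[OF A] .
  have "op_powr A (1/2) (op_powr A (-1/2) x) = x" "op_powr A (-1/2) (op_powr A (1/2) x) = x" for x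
    using op_powr_compose[OF a Ab, of "1/2" "-1/2"] op_powr_compose[OF a Ab, of "-1/2" "1/2"]
      op_powr_0[OF a Ab]
    by (metis add.commute add_uminus_conv_diff blinfun_apply_blinfun_compose blinfun_apply_id_blinfun
      cancel_comm_monoid_add_class.diff_cancel id_apply minus_divide_left)+
  then show ?thesis by (intro blinfun_eqI) (simp add: op_transfer_def)
qed

text \<open>
  The operator counterpart of \<open>a g(b / a)\<close>. It covers \<open>A \<natural>\<^sub>q B\<close> with \<open>g(t) = t\<^sup>q\<close> and the relative
  entropy with \<open>g(t) = t\<^sup>q f(t)\<close>, and it is linear and monotone in \<open>g\<close>.
\<close>

definition perspective :: "(real \<Rightarrow> real) \<Rightarrow> ('h::complex_hilbert \<Rightarrow>\<^sub>L 'h) \<Rightarrow> ('h \<Rightarrow>\<^sub>L 'h) \<Rightarrow> ('h \<Rightarrow>\<^sub>L 'h)" where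
  "perspective g A B = op_powr A (1/2) o\<^sub>L cfc g (op_transfer A B) o\<^sub>L op_powr A (1/2)"

lemma op_natural_eq_perspective: "op_natural q A B = perspective (\<lambda>t. t powr q) A B"
  by (simp add: op_natural_def perspective_def op_powr_def)

lemma op_entropy_eq_perspective:
  assumes "0 < m" "op_between m M (op_transfer A B)" "continuous_on {m..M} f"
  shows "op_entropy q f A B = perspective (\<lambda>t. t powr q * f t) A B"
  unfolding op_entropy_def perspective_def op_powr_def[of "op_transfer A B"]
    cfc_mult[OF assms(2) continuous_on_powr_const[OF assms(1)] assms(3)]
  by (rule blinfun_eqI) simp

locale comparable_operators =
  fixes A B :: "'h::complex_hilbert \<Rightarrow>\<^sub>L 'h" and m M :: real
  assumes A: "strictly_positive A" and m: "0 < m"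
    and low: "m *\<^sub>R A \<preceq>\<^sub>L B" and upp: "B \<preceq>\<^sub>L M *\<^sub>R A"
begin

lemma transfer: "op_between m M (op_transfer A B)"
  by (rule op_transfer_between[OF A low upp])

lemma sqrt_self_adjoint: "self_adjoint (op_powr A (1/2))"
  using strictly_positive_between[OF A] op_powr_self_adjoint by metis

lemma perspective_self_adjoint: "continuous_on {m..M} g \<Longrightarrow> self_adjoint (perspective g A B)"
  unfolding perspective_def
  by (intro self_adjoint_sandwich sqrt_self_adjoint cfc_self_adjoint[OF transfer])

lemma quad_perspective:
  "quad (perspective g A B) x = quad (cfc g (op_transfer A B)) (op_powr A (1/2) x)"
  unfolding perspective_def by (rule quad_sandwich[OF sqrt_self_adjoint])

lemma quad_perspective_linear:
  assumes "continuous_on {m..M} g" "continuous_on {m..M} h"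
  shows "quad (perspective (\<lambda>t. r * g t + s * h t) A B) x
    = r * quad (perspective g A B) x + s * quad (perspective h A B) x"
  by (simp add: quad_perspective cfc_linear[OF transfer assms])

lemma quad_perspective_mono:
  assumes "continuous_on {m..M} g" "continuous_on {m..M} h" "\<And>t. t \<in> {m..M} \<Longrightarrow> g t \<le> h t"
  shows "quad (perspective g A B) x \<le> quad (perspective h A B) x"
  unfolding quad_perspective by (rule cfc_mono[OF transfer assms])

lemma quad_perspective_const: "quad (perspective (\<lambda>_. c) A B) x = c * quad A x"
proof -
  obtain a b where "0 < a" "op_between a b A" using strictly_positive_between[OF A] .
  then show ?thesis by (simp add: quad_perspective cfc_const[OF transfer] norm_op_powr_half)
qed

lemma perspective_ident: "perspective (\<lambda>t. t) A B = B"
  unfolding perspective_def cfc_ident[OF transfer] by (rule op_transfer_sandwich[OF A])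

lemma norm_perspective_le:
  assumes g: "continuous_on {m..M} g" and c: "\<And>t. t \<in> {m..M} \<Longrightarrow> \<bar>g t\<bar> \<le> c" and c0: "0 \<le> c"
  shows "norm (perspective g A B) \<le> c * norm A"
proof (rule self_adjoint_norm_le[OF perspective_self_adjoint[OF g]])
  fix x
  have "quad (perspective g A B) x \<le> quad (perspective (\<lambda>_. c) A B) x"
    using c by (intro quad_perspective_mono[OF g]) (auto simp: abs_le_iff)
  moreover have "quad (perspective (\<lambda>_. - c) A B) x \<le> quad (perspective g A B) x"
  proof (rule quad_perspective_mono[OF _ g])
    show "- c \<le> g t" if "t \<in> {m..M}" for t using c[OF that] by linarith
  qed simp
  ultimately have "\<bar>quad (perspective g A B) x\<bar> \<le> c * quad A x"
    unfolding quad_perspective_const by (simp add: abs_le_iff)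
  also have "\<dots> \<le> c * (norm A * (norm x)\<^sup>2)"
    using abs_quad_le[of A x] c0 by (intro mult_left_mono) auto
  finally show "\<bar>quad (perspective g A B) x\<bar> \<le> c * norm A * (norm x)\<^sup>2" by (simp add: mult.assoc)
qed (simp add: c0)

end

text \<open>
  Operators close to \<open>A s\<close> share its positive lower bound up to a factor \<open>1/2\<close>, so their powers are
  values of the functional calculus on one common interval away from \<open>0\<close>.
\<close>

lemma op_powr_continuous:
  fixes A :: "'t::topological_space \<Rightarrow> ('h::complex_hilbert \<Rightarrow>\<^sub>L 'h)"
  assumes A: "(A \<longlongrightarrow> A s) (at s)" and pos: "\<And>t. strictly_positive (A t)"
  shows "((\<lambda>t. op_powr (A t) q) \<longlongrightarrow> op_powr (A s) q) (at s)"
proof -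
  obtain a b where a: "0 < a" and Ab: "op_between a b (A s)" using strictly_positive_between[OF pos] .
  have near: "op_between (a / 2) (b + a / 2) (A t)" if "norm (A t - A s) \<le> a / 2" for t
    unfolding op_between_def
  proof (intro conjI allI)
    show "self_adjoint (A t)" using strictly_positive_between[OF pos[of t]] by (auto simp: op_between_def)
    fix x
    have "\<bar>quad (A t) x - quad (A s) x\<bar> \<le> norm (A t - A s) * (norm x)\<^sup>2"
      using abs_quad_le[of "A t - A s" x] by simp
    also have "\<dots> \<le> a / 2 * (norm x)\<^sup>2" using that by (intro mult_right_mono) auto
    finally have d: "\<bar>quad (A t) x - quad (A s) x\<bar> \<le> a / 2 * (norm x)\<^sup>2" .
    have "a * (norm x)\<^sup>2 \<le> quad (A s) x" "quad (A s) x \<le> b * (norm x)\<^sup>2"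
      using Ab by (auto simp: op_between_def)
    moreover have "a * (norm x)\<^sup>2 = a / 2 * (norm x)\<^sup>2 + a / 2 * (norm x)\<^sup>2" by simp
    moreover have "(b + a / 2) * (norm x)\<^sup>2 = b * (norm x)\<^sup>2 + a / 2 * (norm x)\<^sup>2"
      by (rule distrib_right)
    ultimately show "a / 2 * (norm x)\<^sup>2 \<le> quad (A t) x" "quad (A t) x \<le> (b + a / 2) * (norm x)\<^sup>2"
      using d by linarith+
  qed
  have "\<forall>\<^sub>F t in at s. dist (A t) (A s) < a / 2" using A a by (intro tendstoD) auto
  then have "\<forall>\<^sub>F t in at s. op_between (a / 2) (b + a / 2) (A t)"
    by eventually_elim (intro near, simp add: dist_norm)
  moreover have "op_between (a / 2) (b + a / 2) (A s)" using near[of s] a by simp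
  ultimately show ?thesis
    unfolding op_powr_def using a
    by (intro cfc_continuous[OF A]) (auto intro: continuous_on_powr_const)
qed

text \<open>
  Integrability follows from \<open>norm_perspective_le\<close>, with the supremum of \<open>\<bar>g\<bar>\<close> on \<open>{m..M}\<close> as
  constant.
\<close>

lemma continuous_field_perspective:
  fixes A B :: "'t::t2_space \<Rightarrow> ('h::complex_hilbert \<Rightarrow>\<^sub>L 'h)"
  assumes \<A>: "cstar_algebra \<A>" "id_blinfun \<in> \<A>" and \<mu>: "radon_measure \<mu>"
    and A: "continuous_field \<A> \<mu> A" and B: "continuous_field \<A> \<mu> B"
    and AB: "\<And>t. comparable_operators (A t) (B t) m M" and g: "continuous_on {m..M} g"
  shows "continuous_field \<A> \<mu> (\<lambda>t. perspective g (A t) (B t))"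
  unfolding continuous_field_def
proof (intro conjI allI)
  have pos: "strictly_positive (A t)" for t using AB[of t] by (rule comparable_operators.A)
  have T: "op_between m M (op_transfer (A t) (B t))" for t by (rule comparable_operators.transfer[OF AB])
  have mult: "X o\<^sub>L Y \<in> \<A>" if "X \<in> \<A>" "Y \<in> \<A>" for X Y
    using \<A>(1) that by (simp add: cstar_algebra_def)
  have fields: "A t \<in> \<A>" "B t \<in> \<A>" for t using A B by (auto simp: continuous_field_def)
  have powA: "op_powr (A t) q \<in> \<A>" for t q
  proof -
    obtain a b where "0 < a" "op_between a b (A t)" using strictly_positive_between[OF pos] .
    then show ?thesis
      unfolding op_powr_def by (intro cfc_in_algebra[OF \<A> fields(1)] continuous_on_powr_const)
  qed
  have TA: "op_transfer (A t) (B t) \<in> \<A>" for t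
    unfolding op_transfer_def by (intro mult powA fields)
  show "perspective g (A t) (B t) \<in> \<A>" for t
    unfolding perspective_def by (intro mult powA cfc_in_algebra[OF \<A> TA T g])
  show cont: "continuous_on UNIV (\<lambda>t. perspective g (A t) (B t))"
    unfolding continuous_on_def
  proof
    fix s
    have lim: "(A \<longlongrightarrow> A s) (at s)" "(B \<longlongrightarrow> B s) (at s)"
      using A B by (auto simp: continuous_field_def continuous_on_def)
    note comp = bounded_bilinear.tendsto[OF bounded_bilinear_blinfun_compose]
    have "((\<lambda>t. op_transfer (A t) (B t)) \<longlongrightarrow> op_transfer (A s) (B s)) (at s)"
      unfolding op_transfer_def by (intro comp op_powr_continuous lim pos)
    then have "((\<lambda>t. cfc g (op_transfer (A t) (B t))) \<longlongrightarrow> cfc g (op_transfer (A s) (B s))) (at s)"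
      using T g by (intro cfc_continuous) auto
    then show "((\<lambda>t. perspective g (A t) (B t)) \<longlongrightarrow> perspective g (A s) (B s)) (at s within UNIV)"
      unfolding perspective_def by (intro comp op_powr_continuous lim pos)
  qed
  have "bounded (g ` {m..M})" using g by (intro compact_imp_bounded compact_continuous_image) auto
  then obtain c where c: "0 < c" "\<forall>y\<in>g ` {m..M}. norm y \<le> c" unfolding bounded_pos by blast
  have "integrable \<mu> (\<lambda>t. c * norm (A t))" using A by (simp add: continuous_field_def)
  then show "integrable \<mu> (\<lambda>t. norm (perspective g (A t) (B t)))"
  proof (rule Bochner_Integration.integrable_bound)
    show "(\<lambda>t. norm (perspective g (A t) (B t))) \<in> borel_measurable \<mu>"
      by (rule radon_borel_measurable[OF \<mu> continuous_on_norm[OF cont]])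
    have "norm (perspective g (A t) (B t)) \<le> c * norm (A t)" for t
      using c by (intro comparable_operators.norm_perspective_le[OF AB g]) auto
    then show "AE t in \<mu>. norm (norm (perspective g (A t) (B t))) \<le> norm (c * norm (A t))"
      using c(1) by (intro AE_I2) simp
  qed
qed


section \<open>The inequality\<close>

locale comparable_fields =
  fixes \<A> :: "('h::complex_hilbert \<Rightarrow>\<^sub>L 'h) set" and \<mu> :: "('t::t2_space) measure"
    and A B :: "'t \<Rightarrow> ('h \<Rightarrow>\<^sub>L 'h)" and m M :: real
  assumes algebra: "cstar_algebra \<A>" and radon: "radon_measure \<mu>"
    and A: "continuous_field \<A> \<mu> A" and B: "continuous_field \<A> \<mu> B"
    and AB: "\<And>t. comparable_operators (A t) (B t) m M"
    and intA: "op_integral \<A> \<mu> A = id_blinfun" and intB: "op_integral \<A> \<mu> B = id_blinfun"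
begin

text \<open>
  A positive linear map from the continuous functions on \<open>{m..M}\<close> to operators, with \<open>\<Phi> 1\<close> and
  \<open>\<Phi> t\<close> both the identity. Its properties are stated for quadratic forms, in which the order is
  expressed.
\<close>

definition \<Phi> :: "(real \<Rightarrow> real) \<Rightarrow> ('h \<Rightarrow>\<^sub>L 'h)" where
  "\<Phi> g = op_integral \<A> \<mu> (\<lambda>t. perspective g (A t) (B t))"

lemma field: "continuous_on {m..M} g \<Longrightarrow> continuous_field \<A> \<mu> (\<lambda>t. perspective g (A t) (B t))"
  using op_integral_in_algebra[OF algebra radon A] unfolding intA
  by (intro continuous_field_perspective[OF _ _ _ _ _ AB] algebra radon A B)

lemma \<Phi>_self_adjoint: "continuous_on {m..M} g \<Longrightarrow> self_adjoint (\<Phi> g)"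
  unfolding \<Phi>_def
  by (intro self_adjoint_op_integral algebra radon field comparable_operators.perspective_self_adjoint[OF AB])

lemma \<Phi>_quad:
  assumes "continuous_on {m..M} g"
  shows "integrable \<mu> (\<lambda>t. quad (perspective g (A t) (B t)) x)"
    and "quad (\<Phi> g) x = (\<integral>t. quad (perspective g (A t) (B t)) x \<partial>\<mu>)"
  unfolding \<Phi>_def by (rule quad_op_integral[OF algebra radon field[OF assms]])+

lemma \<Phi>_mono:
  assumes "continuous_on {m..M} g" "continuous_on {m..M} h" "\<And>t. t \<in> {m..M} \<Longrightarrow> g t \<le> h t"
  shows "quad (\<Phi> g) x \<le> quad (\<Phi> h) x"
  using assms unfolding \<Phi>_quad(2)[OF assms(1)] \<Phi>_quad(2)[OF assms(2)]
  by (intro integral_mono \<Phi>_quad(1) comparable_operators.quad_perspective_mono[OF AB])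

lemma \<Phi>_linear:
  assumes g: "continuous_on {m..M} g" and h: "continuous_on {m..M} h"
  shows "quad (\<Phi> (\<lambda>t. r * g t + s * h t)) x = r * quad (\<Phi> g) x + s * quad (\<Phi> h) x"
proof -
  have "continuous_on {m..M} (\<lambda>t. r * g t + s * h t)" using g h by (intro continuous_intros)
  then show ?thesis
    by (simp add: \<Phi>_quad g h comparable_operators.quad_perspective_linear[OF AB g h])
qed

lemma \<Phi>_one: "quad (\<Phi> (\<lambda>_. 1)) x = (norm x)\<^sup>2"
  using quad_op_integral(2)[OF algebra radon A, of x] unfolding intA
  by (simp add: \<Phi>_quad comparable_operators.quad_perspective_const[OF AB])

lemma \<Phi>_ident: "quad (\<Phi> (\<lambda>t. t)) x = (norm x)\<^sup>2"
  using quad_op_integral(2)[OF algebra radon B, of x] unfolding intB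
  by (simp add: \<Phi>_quad comparable_operators.perspective_ident[OF AB])

end

lemma powr_le_affine:
  fixes t p :: real
  assumes "0 < t" "0 \<le> p" "p \<le> 1"
  shows "t powr p \<le> (1 - p) * 1 + p * t"
  using Youngs_inequality_0[of p "1 - p" t 1] assms by (simp add: powr_def)

text \<open>
  The upper affine bound on \<open>f\<close> is applied to \<open>f(Z)\<close> with \<open>Z = Q + t0 (I - P)\<close>, the lower one under
  the integral and at \<open>t0\<close>. The affine parts cancel because \<open>I = P + (I - P)\<close>.
\<close>

lemma (in comparable_fields) entropy_bound:
  fixes f :: "real \<Rightarrow> real" and t0 p a b z :: real
  assumes f: "continuous_on {m..M} f" and m: "0 < m"
    and low: "\<And>t. t \<in> {m..M} \<Longrightarrow> a * t + b \<le> f t"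
    and upp: "\<And>t. t \<in> {m..M} \<Longrightarrow> f t \<le> a * t + b + z"
    and t0: "t0 \<in> {m..M}" and p: "p \<in> {0..1}"
  defines "P \<equiv> op_integral \<A> \<mu> (\<lambda>s. op_natural p (A s) (B s))"
    and "Q \<equiv> op_integral \<A> \<mu> (\<lambda>s. op_natural (p + 1) (A s) (B s))"
  shows "cfc f (Q + t0 *\<^sub>R (id_blinfun - P)) - f t0 *\<^sub>R (id_blinfun - P)
    \<preceq>\<^sub>L relative_entropy \<A> \<mu> p f A B + z *\<^sub>R id_blinfun"
proof -
  have P: "P = \<Phi> (\<lambda>t. t powr p)" and Q: "Q = \<Phi> (\<lambda>t. t powr (p + 1))"
    by (simp_all add: P_def Q_def \<Phi>_def op_natural_eq_perspective)
  have E: "relative_entropy \<A> \<mu> p f A B = \<Phi> (\<lambda>t. t powr p * f t)"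
    unfolding relative_entropy_def \<Phi>_def
    by (simp add: op_entropy_eq_perspective[OF m comparable_operators.transfer[OF AB] f])
  note pw = continuous_on_powr_const[OF m, of M]
  have pf: "continuous_on {m..M} (\<lambda>t. t powr p * f t)" by (intro continuous_on_mult pw f)
  have P1: "quad P x \<le> (norm x)\<^sup>2" for x
  proof -
    have "quad P x \<le> quad (\<Phi> (\<lambda>t. (1 - p) * 1 + p * t)) x"
      unfolding P using m p by (intro \<Phi>_mono pw powr_le_affine) (auto intro!: continuous_intros)
    also have "\<dots> = (norm x)\<^sup>2"
      by (subst \<Phi>_linear) (auto simp: \<Phi>_one \<Phi>_ident algebra_simps)
    finally show ?thesis .
  qed
  have scale: "quad (\<Phi> (\<lambda>t. c * t powr p)) x = c * quad P x" for c x
    using \<Phi>_linear[OF pw pw, of c p 0 p x] by (simp add: P)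
  have Qlow: "m * quad P x \<le> quad Q x" and Qupp: "quad Q x \<le> M * quad P x" for x
    unfolding scale[symmetric] Q using m
    by (intro \<Phi>_mono pw continuous_on_mult continuous_on_const;
        auto simp: powr_add intro!: mult_right_mono)+
  define Z where "Z = Q + t0 *\<^sub>R (id_blinfun - P)"
  have Zq: "quad Z x = quad Q x + t0 * ((norm x)\<^sup>2 - quad P x)" for x by (simp add: Z_def)
  have Zb: "op_between m M Z"
    unfolding op_between_def
  proof (intro conjI allI)
    show "self_adjoint Z" unfolding Z_def P Q by (intro self_adjoint_simps \<Phi>_self_adjoint pw)
    fix x
    have "m * ((norm x)\<^sup>2 - quad P x) \<le> t0 * ((norm x)\<^sup>2 - quad P x)"
      "t0 * ((norm x)\<^sup>2 - quad P x) \<le> M * ((norm x)\<^sup>2 - quad P x)"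
      using t0 P1[of x] by (auto intro!: mult_right_mono)
    then show "m * (norm x)\<^sup>2 \<le> quad Z x" "quad Z x \<le> M * (norm x)\<^sup>2"
      using Qlow[of x] Qupp[of x] unfolding Zq by (simp_all add: algebra_simps)
  qed
  have fZ: "quad (cfc f Z) x \<le> a * quad Z x + (b + z) * (norm x)\<^sup>2" for x
  proof -
    have "quad (cfc f Z) x \<le> quad (cfc (\<lambda>t. a * t + (b + z) * 1) Z) x"
      using upp by (intro cfc_mono[OF Zb f]) (auto intro!: continuous_intros simp: algebra_simps)
    also have "cfc (\<lambda>t. a * t + (b + z) * 1) Z = a *\<^sub>R cfc (\<lambda>t. t) Z + (b + z) *\<^sub>R cfc (\<lambda>t. 1) Z"
      by (intro cfc_linear[OF Zb]) (auto intro!: continuous_intros)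
    finally show ?thesis by (simp add: cfc_ident[OF Zb] cfc_const[OF Zb])
  qed
  have Elow: "a * quad Q x + b * quad P x \<le> quad (\<Phi> (\<lambda>t. t powr p * f t)) x" for x
  proof -
    have "a * quad Q x + b * quad P x = quad (\<Phi> (\<lambda>t. a * t powr (p + 1) + b * t powr p)) x"
      unfolding P Q by (rule \<Phi>_linear[OF pw pw, symmetric])
    also have "\<dots> \<le> quad (\<Phi> (\<lambda>t. t powr p * f t)) x"
    proof (rule \<Phi>_mono[OF _ pf])
      show "continuous_on {m..M} (\<lambda>t. a * t powr (p + 1) + b * t powr p)"
        by (intro continuous_on_add continuous_on_mult continuous_on_const pw)
      fix t assume t: "t \<in> {m..M}"
      have "a * t powr (p + 1) + b * t powr p = t powr p * (a * t + b)"
        using t m by (simp add: powr_add algebra_simps)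
      also have "\<dots> \<le> t powr p * f t" using low[OF t] by (intro mult_left_mono) auto
      finally show "a * t powr (p + 1) + b * t powr p \<le> t powr p * f t" .
    qed
    finally show ?thesis .
  qed
  show ?thesis
    unfolding op_le_iff E Z_def[symmetric]
  proof (intro conjI allI)
    show "self_adjoint (cfc f Z - f t0 *\<^sub>R (id_blinfun - P))"
      unfolding P by (intro self_adjoint_simps cfc_self_adjoint[OF Zb f] \<Phi>_self_adjoint pw)
    show "self_adjoint (\<Phi> (\<lambda>t. t powr p * f t) + z *\<^sub>R id_blinfun)"
      by (intro self_adjoint_simps \<Phi>_self_adjoint pf)
    fix x
    have "(a * t0 + b) * ((norm x)\<^sup>2 - quad P x) \<le> f t0 * ((norm x)\<^sup>2 - quad P x)"
      using low[OF t0] P1[of x] by (intro mult_right_mono) auto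
    then show "quad (cfc f Z - f t0 *\<^sub>R (id_blinfun - P)) x
        \<le> quad (\<Phi> (\<lambda>t. t powr p * f t) + z *\<^sub>R id_blinfun) x"
      using fZ[of x] Elow[of x] unfolding Zq by (simp add: algebra_simps)
  qed
qed



theorem theorem3p5:
  fixes \<A> :: "('h::complex_hilbert \<Rightarrow>\<^sub>L 'h) set"
    and \<mu> :: "('t::t2_space) measure"
    and A B :: "'t \<Rightarrow> ('h \<Rightarrow>\<^sub>L 'h)"
    and f :: "real \<Rightarrow> real"
    and m M t0 p \<mu>f \<nu>f \<zeta>f :: real
  assumes "cstar_algebra \<A>"
    and "locally compact (UNIV :: 't set)"
    and "radon_measure \<mu>"
    and "continuous_field \<A> \<mu> A"
    and "continuous_field \<A> \<mu> B"
    and "\<And>s. strictly_positive (A s)"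
    and "\<And>s. strictly_positive (B s)"
    and "0 < m" and "m < 1" and "1 < M"
    and "\<And>s. m *\<^sub>R A s \<preceq>\<^sub>L B s"
    and "\<And>s. B s \<preceq>\<^sub>L M *\<^sub>R A s"
    and "op_integral \<A> \<mu> A = id_blinfun"
    and "op_integral \<A> \<mu> B = id_blinfun"
    and "\<And>t. 0 < t \<Longrightarrow> 0 \<le> f t"
    and "operator_concave TYPE('h + nat \<Rightarrow> complex) {0<..} f"
    and "t0 \<in> {m..M}"
    and "p \<in> {0..1}"
    and "\<mu>f = (f M - f m) / (M - m)"
    and "\<nu>f = (M * f m - m * f M) / (M - m)"
    and "\<zeta>f = (GREATEST z. z \<in> (\<lambda>t. f t - \<mu>f * t - \<nu>f) ` {m..M})"
  shows "cfc f (op_integral \<A> \<mu> (\<lambda>s. op_natural (p + 1) (A s) (B s))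
             + t0 *\<^sub>R (id_blinfun - op_integral \<A> \<mu> (\<lambda>s. op_natural p (A s) (B s))))
           - f t0 *\<^sub>R (id_blinfun - op_integral \<A> \<mu> (\<lambda>s. op_natural p (A s) (B s)))
         \<preceq>\<^sub>L relative_entropy \<A> \<mu> p f A B + \<zeta>f *\<^sub>R id_blinfun"
proof -
  have mM: "m < M" using assms(9,10) by simp
  have conc: "concave_on {0<..} f" by (rule operator_concave_imp_concave[OF assms(16)])
  have "continuous_on {0<..} f" using assms(16) by (simp add: operator_concave_def)
  then have f: "continuous_on {m..M} f"
    by (rule continuous_on_subset) (use assms(8) in auto)
  interpret comparable_fields \<A> \<mu> A B m M
    by (intro comparable_fields.intro comparable_operators.intro assms)
  let ?h = "\<lambda>t. f t - \<mu>f * t - \<nu>f"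
  have "continuous_on {m..M} ?h" using f by (intro continuous_intros)
  then obtain t where t: "t \<in> {m..M}" "\<And>s. s \<in> {m..M} \<Longrightarrow> ?h s \<le> ?h t"
    using continuous_attains_sup[of "{m..M}" ?h] mM by auto
  \<comment> \<open>the maximum is attained, so \<open>GREATEST\<close> denotes it\<close>
  have "\<zeta>f = ?h t"
    unfolding assms(21) using t by (intro Greatest_equality) auto
  then have upp: "f s \<le> \<mu>f * s + \<nu>f + \<zeta>f" if "s \<in> {m..M}" for s
    using t(2)[OF that] by linarith
  have low: "\<mu>f * s + \<nu>f \<le> f s" if "s \<in> {m..M}" for s
    unfolding assms(19,20)
    by (rule concave_on_above_chord[OF conc]) (use that assms(8) mM in auto)
  show ?thesis by (rule entropy_bound[OF f assms(8) low upp assms(17,18)])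
qed

end
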